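(* Let $\Omega$, $\Sigma$, $D_0$, $\mathbb{C}^i,\mathbb{C}^e$, $\mathbb{C}^{D_0}$ and the normalized vector field $\widetilde{\mathcal{U}}$ be as in the context. Let $f,g\in H^{1/2}_{co}(\Sigma)$ and let $u_0,v_0\in H^1(\Omega)$ solve $\mathrm{div}(\mathbb{C}^{D_0}\nabla u_0)=0$, $\mathrm{div}(\mathbb{C}^{D_0}\nabla v_0)=0$ in $\Omega$ with $u_0=f$, $v_0=g$ on $\partial\Omega$. Let $$b=(\mathbb{C}^{D_0}\nabla u_0\cdot\nabla v_0)\,\widetilde{\mathcal{U}}-(\mathbb{C}^{D_0}\nabla u_0)(\nabla v_0\,\widetilde{\mathcal{U}})-(\mathbb{C}^{D_0}\nabla v_0)(\nabla u_0\,\widetilde{\mathcal{U}})$$ and let $b^e$, $b^i$ be the restrictions of $b$ to $\Omega\setminus D_0$ and $D_0$, respectively. Then on $\partial D_0\setminus\bigcup_{i\ne j}\sigma_{ij}^{D_0}$ (the boundary of $D_0$ deprived of its edges) $$(b^i-b^e)\cdot n=-(\widetilde{\mathcal{U}}\cdot n)\,\mathbb{M}\widehat\nabla u_0^e\cdot\widehat\nabla v_0^e,$$ where $n$ is the unit outer normal to $D_0$, $u_0^e=u_0|_{\Omega\setminus D_0}$, $v_0^e=v_0|_{\Omega\setminus D_0}$, and $\mathbb{M}$ is the elastic moment tensor defined in the context.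
   Context: $r_0>0$ is given; $\Omega\subset\mathbb{R}^3$ is a bounded domain with Lipschitz boundary, $\Sigma\subset\partial\Omega$ is open, and $D_0,D_1$ are closed polyhedra contained in $\Omega$ at distance at least $r_0$ from $\partial\Omega$ (sets homeomorphic to a closed ball, with boundary a finite union of plane polygonal faces, and $\Omega\setminus D_j$ with Lipschitz boundary) having the same number $N$ of vertices $V_i^{D_0}$, $V_i^{D_1}$, correspondingly ordered. $\mathcal{U}\in W^{1,\infty}(\mathbb{R}^3,\mathbb{R}^3)$ is a vector field with $\mathcal{U}(V_i^{D_0})=V_i^{D_1}-V_i^{D_0}$ for all $i$ and $\mathrm{supp}\,\mathcal{U}\subset\{\mathrm{dist}(x,D_0)\le r_0/4\}$. $W=(V_1^{D_1}-V_1^{D_0},\dots,V_N^{D_1}-V_N^{D_0})$ is assumed nonzero and $\widetilde{\mathcal{U}}=\mathcal{U}/|W|$. $\sigma_{ij}^{D_0}$ denote the edges of $D_0$. $\mathbb{C}^{D_0}=\mathbb{C}^i\chi_{D_0}+\mathbb{C}^e\chi_{\Omega\setminus D_0}$, where $\mathbb{C}^sA=2\mu^s\widehat A+\lambda^s(\mathrm{tr}A)I_3$ with constant $\lambda^s,\mu^s$, $\mu^s>0$, $2\mu^s+3\lambda^s>0$, $0\le\frac{\lambda^s}{2(\lambda^s+\mu^s)}<\frac12$, $s\in\{i,e\}$; $\widehat A=\frac12(A+A^T)$, $\widehat\nabla u=\widehat{\nabla u}$. Elastic moment tensor: at a point of the relative interior of a face with unit normal $n$, let $Q$ be the $3\times3$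 matrix with $(Q^{-1}\zeta)\cdot\eta=\mathbb{C}^i(\zeta\otimes n)\cdot(\eta\otimes n)$ for all $\zeta,\eta\in\mathbb{R}^3$, and for symmetric $A$ set $$\mathbb{M}A=(\mathbb{C}^e-\mathbb{C}^i)A+(\mathbb{C}^e-\mathbb{C}^i)\big[\big(Q((\mathbb{C}^e-\mathbb{C}^i)A\,n)\big)\otimes n\big].$$ It satisfies $(\mathbb{C}^e-\mathbb{C}^i)\nabla u_0^i=\mathbb{M}\widehat\nabla u_0^e$ there, $u_0^i=u_0|_{D_0}$. Notation: $(\nabla u)_{ij}=\partial u_i/\partial x_j$; juxtaposition is the matrix-vector product; $A\cdot B=\sum A_{ij}B_{ij}$; $(a\otimes b)_{ij}=a_ib_j$. $H^{1/2}_{co}(\Sigma)=\{\varphi\in H^{1/2}(\partial\Omega;\mathbb{R}^3):\mathrm{supp}\,\varphi\subset\Sigma\}$. Solutions are smooth up to the relative interior of each face from either side, and boundary values of gradients are the corresponding one-sided traces. *)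

theory Defs
  imports "HOL-Analysis.Analysis"
begin

section \<open>Smooth functions\<close>

definition extends_continuously ::
  "(real^3) set \<Rightarrow> (real^3) set \<Rightarrow> (real^3 \<Rightarrow> 'b::real_normed_vector) \<Rightarrow> bool" where
  "extends_continuously S T f \<longleftrightarrow>
     (\<exists>g. continuous_on (S \<union> T) g \<and> (\<forall>x\<in>S. g x = f x))"

text \<open>For open \<open>S\<close> and \<open>T \<subseteq> closure S\<close>: \<open>f\<close> is \<open>C\<^sup>k\<close> on \<open>S\<close>, and all its derivatives of order at
  most \<open>k\<close> extend continuously to \<open>S \<union> T\<close>. The values of \<open>f\<close> outside \<open>S\<close> are irrelevant.\<close>

primrec Ck_upto ::
  "nat \<Rightarrow> (real^3) set \<Rightarrow> (real^3) set \<Rightarrow> (real^3 \<Rightarrow> 'b::real_normed_vector) \<Rightarrow> bool" where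
  "Ck_upto 0 S T f \<longleftrightarrow> extends_continuously S T f"
| "Ck_upto (Suc k) S T f \<longleftrightarrow>
     extends_continuously S T f \<and> f differentiable_on S \<and>
     (\<forall>v. Ck_upto k S T (\<lambda>x. frechet_derivative f (at x) v))"

definition smooth_upto ::
  "(real^3) set \<Rightarrow> (real^3) set \<Rightarrow> (real^3 \<Rightarrow> 'b::real_normed_vector) \<Rightarrow> bool" where
  "smooth_upto S T f \<longleftrightarrow> (\<forall>k. Ck_upto k S T f)"

definition test_function :: "(real^3) set \<Rightarrow> (real^3 \<Rightarrow> 'b::real_normed_vector) \<Rightarrow> bool" where
  "test_function \<Omega> \<phi> \<longleftrightarrow>
     smooth_upto UNIV {} \<phi> \<and> compact (closure {x. \<phi> x \<noteq> 0}) \<and> closure {x. \<phi> x \<noteq> 0} \<subseteq> \<Omega>"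


section \<open>Sobolev spaces\<close>

text \<open>In all gradients the entry \<open>(i, j)\<close> is \<open>\<partial>u\<^sub>i/\<partial>x\<^sub>j\<close>, as for \<^const>\<open>jacobian\<close>.\<close>

definition weak_gradient ::
  "(real^3) set \<Rightarrow> (real^3 \<Rightarrow> real^3) \<Rightarrow> (real^3 \<Rightarrow> real^3^3) \<Rightarrow> bool" where
  "weak_gradient \<Omega> u G \<longleftrightarrow>
     (\<forall>K. compact K \<and> K \<subseteq> \<Omega> \<longrightarrow> set_integrable lebesgue K u \<and> set_integrable lebesgue K G) \<and>
     (\<forall>\<phi>::real^3 \<Rightarrow> real. test_function \<Omega> \<phi> \<longrightarrow>
        (\<forall>i j. (LINT x:\<Omega>|lebesgue. u x $ i * frechet_derivative \<phi> (at x) (axis j 1))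
             = - (LINT x:\<Omega>|lebesgue. G x $ i $ j * \<phi> x)))"

definition L2_on :: "(real^3) set \<Rightarrow> (real^3 \<Rightarrow> 'b::euclidean_space) \<Rightarrow> bool" where
  "L2_on \<Omega> u \<longleftrightarrow>
     set_borel_measurable lebesgue \<Omega> u \<and> set_integrable lebesgue \<Omega> (\<lambda>x. (norm (u x))\<^sup>2)"

definition H1_with_gradient ::
  "(real^3) set \<Rightarrow> (real^3 \<Rightarrow> real^3) \<Rightarrow> (real^3 \<Rightarrow> real^3^3) \<Rightarrow> bool" where
  "H1_with_gradient \<Omega> u G \<longleftrightarrow> weak_gradient \<Omega> u G \<and> L2_on \<Omega> u \<and> L2_on \<Omega> G"

text \<open>\<open>W\<^sup>1\<^sup>,\<^sup>\<infinity>(\<real>\<^sup>3; \<real>\<^sup>3)\<close>. Each class has a unique continuous representative, and it is the one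
  meant here, since point values are used.\<close>

definition W1_infty :: "(real^3 \<Rightarrow> real^3) \<Rightarrow> bool" where
  "W1_infty U \<longleftrightarrow> continuous_on UNIV U \<and>
     (\<exists>G C. weak_gradient UNIV U G \<and> (AE x in lebesgue. norm (U x) \<le> C \<and> norm (G x) \<le> C))"


section \<open>Surface measure, boundary values\<close>

text \<open>Two-dimensional Hausdorff measure, normalised to agree with area. Covering sets are
  required to be bounded because \<^const>\<open>diameter\<close> is unspecified otherwise.\<close>

definition hausdorff2_pre :: "real \<Rightarrow> (real^3) set \<Rightarrow> ennreal" where
  "hausdorff2_pre \<delta> A =
     (INF C \<in> {C :: nat \<Rightarrow> (real^3) set. A \<subseteq> (\<Union>n. C n) \<and> (\<forall>n. bounded (C n) \<and> diameter (C n) \<le> \<delta>)}.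
        (\<Sum>n. ennreal (pi * (diameter (C n) / 2)\<^sup>2)))"

definition hausdorff2 :: "(real^3) measure" where
  "hausdorff2 = measure_of UNIV (sets borel) (\<lambda>A. SUP \<delta>\<in>{0<..}. hausdorff2_pre \<delta> A)"

definition surface_measure :: "(real^3) set \<Rightarrow> (real^3) measure" where
  "surface_measure S = restrict_space hausdorff2 S"

text \<open>\<open>H\<^sup>1\<^sup>/\<^sup>2(\<partial>\<Omega>; \<real>\<^sup>3)\<close> with the Sobolev-Slobodeckij seminorm of a two-dimensional surface.\<close>

definition H_half :: "(real^3) set \<Rightarrow> (real^3 \<Rightarrow> real^3) \<Rightarrow> bool" where
  "H_half \<Omega> \<phi> \<longleftrightarrow>
     \<phi> \<in> borel_measurable (surface_measure (frontier \<Omega>)) \<and>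
     (\<integral>\<^sup>+x. ennreal ((norm (\<phi> x))\<^sup>2) \<partial>surface_measure (frontier \<Omega>)) < \<infinity> \<and>
     (\<integral>\<^sup>+x. (\<integral>\<^sup>+y. ennreal ((norm (\<phi> x - \<phi> y))\<^sup>2 / norm (x - y) ^ 3)
        \<partial>surface_measure (frontier \<Omega>)) \<partial>surface_measure (frontier \<Omega>)) < \<infinity>"

text \<open>The support of the almost-everywhere class of \<open>\<phi>\<close> on \<open>\<partial>\<Omega>\<close>.\<close>

definition boundary_support :: "(real^3) set \<Rightarrow> (real^3 \<Rightarrow> real^3) \<Rightarrow> (real^3) set" where
  "boundary_support \<Omega> \<phi> =
     {x \<in> frontier \<Omega>. \<forall>\<epsilon>>0.
        emeasure (surface_measure (frontier \<Omega>)) {y \<in> frontier \<Omega> \<inter> ball x \<epsilon>. \<phi> y \<noteq> 0} > 0}"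

definition H_half_co :: "(real^3) set \<Rightarrow> (real^3) set \<Rightarrow> (real^3 \<Rightarrow> real^3) \<Rightarrow> bool" where
  "H_half_co \<Omega> S \<phi> \<longleftrightarrow> H_half \<Omega> \<phi> \<and> boundary_support \<Omega> \<phi> \<subseteq> S"

text \<open>\<open>f\<close> is the trace on \<open>\<partial>\<Omega>\<close> of the \<open>H\<^sup>1\<close> function \<open>u\<close> with weak gradient \<open>G\<close>.\<close>

definition has_boundary_trace ::
  "(real^3) set \<Rightarrow> (real^3 \<Rightarrow> real^3) \<Rightarrow> (real^3 \<Rightarrow> real^3^3) \<Rightarrow> (real^3 \<Rightarrow> real^3) \<Rightarrow> bool" where
  "has_boundary_trace \<Omega> u G f \<longleftrightarrow>
     (\<exists>\<phi> :: nat \<Rightarrow> real^3 \<Rightarrow> real^3.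
        (\<forall>k. smooth_upto UNIV {} (\<phi> k)) \<and>
        (\<lambda>k. \<integral>\<^sup>+x\<in>\<Omega>. ennreal ((norm (\<phi> k x - u x))\<^sup>2 + (norm (jacobian (\<phi> k) (at x) - G x))\<^sup>2)
               \<partial>lebesgue) \<longlonglongrightarrow> 0 \<and>
        (\<lambda>k. \<integral>\<^sup>+x. ennreal ((norm (\<phi> k x - f x))\<^sup>2) \<partial>surface_measure (frontier \<Omega>)) \<longlonglongrightarrow> 0)"


section \<open>Domains and polyhedra\<close>

text \<open>Near each boundary point, \<open>A\<close> is the part above the graph of a Lipschitz function over the
  plane orthogonal to some unit vector \<open>e\<close>.\<close>

definition lipschitz_boundary :: "(real^3) set \<Rightarrow> bool" where
  "lipschitz_boundary A \<longleftrightarrow>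
     (\<forall>p \<in> frontier A. \<exists>e (\<psi> :: real^3 \<Rightarrow> real) L r.
        norm e = 1 \<and> r > 0 \<and> L-lipschitz_on UNIV \<psi> \<and>
        A \<inter> ball p r = {x \<in> ball p r. \<psi> (x - (x \<bullet> e) *\<^sub>R e) < x \<bullet> e})"

definition edge_segment :: "(nat \<Rightarrow> real^3) \<Rightarrow> nat \<times> nat \<Rightarrow> (real^3) set" where
  "edge_segment V e = closed_segment (V (fst e)) (V (snd e))"

definition polygonal_face :: "(nat \<Rightarrow> real^3) \<Rightarrow> (nat \<times> nat) set \<Rightarrow> (real^3) set \<Rightarrow> bool" where
  "polygonal_face V E F \<longleftrightarrow>
     compact F \<and> aff_dim F = 2 \<and> connected (rel_interior F) \<and> F = closure (rel_interior F) \<and>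
     (\<exists>E' \<subseteq> E. rel_frontier F = (\<Union>e\<in>E'. edge_segment V e))"

text \<open>A closed, not necessarily convex, polyhedron \<open>D\<close> with vertices \<open>V 0, \<dots>, V (N - 1)\<close>, edges
  \<open>E\<close> (each given by its pair of vertex indices in increasing order) and faces \<open>\<F>\<close>.
  Different faces in the same plane are allowed to be adjacent.\<close>

definition closed_polyhedron ::
  "(real^3) set \<Rightarrow> nat \<Rightarrow> (nat \<Rightarrow> real^3) \<Rightarrow> (nat \<times> nat) set \<Rightarrow> (real^3) set set \<Rightarrow> bool" where
  "closed_polyhedron D N V E \<F> \<longleftrightarrow>
     D homeomorphic (cball 0 1 :: (real^3) set) \<and>
     inj_on V {..<N} \<and>
     E \<subseteq> {(i, j). i < j \<and> j < N} \<and>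
     (\<forall>i<N. \<exists>e\<in>E. i = fst e \<or> i = snd e) \<and>
     (\<forall>e\<in>E. \<forall>e'\<in>E. e \<noteq> e' \<longrightarrow>
        edge_segment V e \<inter> edge_segment V e' \<subseteq> V ` ({fst e, snd e} \<inter> {fst e', snd e'})) \<and>
     finite \<F> \<and> (\<forall>F\<in>\<F>. polygonal_face V E F) \<and>
     (\<forall>e\<in>E. \<exists>F\<in>\<F>. edge_segment V e \<subseteq> rel_frontier F) \<and>
     (\<forall>F\<in>\<F>. \<forall>F'\<in>\<F>. F \<noteq> F' \<longrightarrow> F \<inter> F' \<subseteq> rel_frontier F \<inter> rel_frontier F') \<and>
     frontier D = \<Union>\<F>"

definition admissible_inclusion :: "real \<Rightarrow> (real^3) set \<Rightarrow> (real^3) set \<Rightarrow> bool" where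
  "admissible_inclusion r0 \<Omega> D \<longleftrightarrow>
     D \<subseteq> \<Omega> \<and> setdist D (frontier \<Omega>) \<ge> r0 \<and> lipschitz_boundary (\<Omega> - D)"

definition outer_unit_normal :: "(real^3) set \<Rightarrow> (real^3) set set \<Rightarrow> real^3 \<Rightarrow> real^3 \<Rightarrow> bool" where
  "outer_unit_normal D \<F> p n \<longleftrightarrow>
     norm n = 1 \<and>
     (\<exists>F\<in>\<F>. p \<in> F \<and> (\<forall>x\<in>F. (x - p) \<bullet> n = 0)) \<and>
     (\<exists>\<epsilon>>0. \<forall>t. 0 < t \<and> t < \<epsilon> \<longrightarrow> p + t *\<^sub>R n \<notin> D)"

text \<open>\<open>|W|\<close> for \<open>W = (V1 0 - V0 0, \<dots>, V1 (N - 1) - V0 (N - 1))\<close>, a vector with \<open>3 N\<close> entries.\<close>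

definition displacement_norm :: "nat \<Rightarrow> (nat \<Rightarrow> real^3) \<Rightarrow> (nat \<Rightarrow> real^3) \<Rightarrow> real" where
  "displacement_norm N V0 V1 = L2_set (\<lambda>i. norm (V1 i - V0 i)) {..<N}"


section \<open>Elasticity\<close>

definition sym_part :: "real^3^3 \<Rightarrow> real^3^3" where
  "sym_part A = (1/2) *\<^sub>R (A + transpose A)"

definition outer_prod :: "real^3 \<Rightarrow> real^3 \<Rightarrow> real^3^3" where
  "outer_prod a b = (\<chi> i j. a $ i * b $ j)"

definition isotropic_tensor :: "real \<Rightarrow> real \<Rightarrow> real^3^3 \<Rightarrow> real^3^3" where
  "isotropic_tensor mu lam A = (2 * mu) *\<^sub>R sym_part A + (lam * trace A) *\<^sub>R mat 1"

definition admissible_lame :: "real \<Rightarrow> real \<Rightarrow> bool" where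
  "admissible_lame mu lam \<longleftrightarrow>
     mu > 0 \<and> 2 * mu + 3 * lam > 0 \<and>
     0 \<le> lam / (2 * (lam + mu)) \<and> lam / (2 * (lam + mu)) < 1/2"

definition piecewise_tensor ::
  "(real^3) set \<Rightarrow> (real^3^3 \<Rightarrow> real^3^3) \<Rightarrow> (real^3^3 \<Rightarrow> real^3^3) \<Rightarrow> real^3 \<Rightarrow> real^3^3 \<Rightarrow> real^3^3" where
  "piecewise_tensor D Ci Ce x = (if x \<in> D then Ci else Ce)"

definition elastic_solution ::
  "(real^3) set \<Rightarrow> (real^3 \<Rightarrow> real^3^3 \<Rightarrow> real^3^3) \<Rightarrow> (real^3 \<Rightarrow> real^3) \<Rightarrow> (real^3 \<Rightarrow> real^3) \<Rightarrow> bool" where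
  "elastic_solution \<Omega> C f u \<longleftrightarrow>
     (\<exists>G. H1_with_gradient \<Omega> u G \<and>
        (\<forall>\<psi> :: real^3 \<Rightarrow> real^3. test_function \<Omega> \<psi> \<longrightarrow>
           (LINT x:\<Omega>|lebesgue. C x (G x) \<bullet> jacobian \<psi> (at x)) = 0) \<and>
        has_boundary_trace \<Omega> u G f)"

text \<open>The representative \<open>u\<close> is smooth in both phases, up to the relative interior of each face
  from either side; the values on the null set \<open>\<partial>D\<close> are irrelevant.\<close>

definition smooth_up_to_faces ::
  "(real^3) set \<Rightarrow> (real^3) set \<Rightarrow> (real^3) set set \<Rightarrow> (real^3 \<Rightarrow> real^3) \<Rightarrow> bool" where
  "smooth_up_to_faces \<Omega> D \<F> u \<longleftrightarrow>
     smooth_upto (interior D) (\<Union>F\<in>\<F>. rel_interior F) u \<and>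
     smooth_upto (\<Omega> - D) (\<Union>F\<in>\<F>. rel_interior F) u"

definition Q_matrix :: "(real^3^3 \<Rightarrow> real^3^3) \<Rightarrow> real^3 \<Rightarrow> real^3^3" where
  "Q_matrix Ci n =
     (THE Q. invertible Q \<and>
        (\<forall>\<zeta> \<eta>. (matrix_inv Q *v \<zeta>) \<bullet> \<eta> = Ci (outer_prod \<zeta> n) \<bullet> outer_prod \<eta> n))"

definition moment_tensor ::
  "(real^3^3 \<Rightarrow> real^3^3) \<Rightarrow> (real^3^3 \<Rightarrow> real^3^3) \<Rightarrow> real^3 \<Rightarrow> real^3^3 \<Rightarrow> real^3^3" where
  "moment_tensor Ci Ce n A =
     (Ce A - Ci A) +
     (let B = outer_prod (Q_matrix Ci n *v ((Ce A - Ci A) *v n)) n in Ce B - Ci B)"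

definition b_field ::
  "(real^3 \<Rightarrow> real^3^3 \<Rightarrow> real^3^3) \<Rightarrow> (real^3 \<Rightarrow> real^3) \<Rightarrow> (real^3 \<Rightarrow> real^3) \<Rightarrow> (real^3 \<Rightarrow> real^3) \<Rightarrow>
   real^3 \<Rightarrow> real^3" where
  "b_field C U u v x =
     (let Du = jacobian u (at x); Dv = jacobian v (at x) in
        (C x Du \<bullet> Dv) *\<^sub>R U x - C x Du *v (Dv *v U x) - C x Dv *v (Du *v U x))"

end

theory Submission
  imports Defs "HOL-Real_Asymp.Real_Asymp"
begin

text \<open>
  Near a point \<open>p\<close> of the relative interior of a face, \<open>D\<close> is a half ball. Testing the weak
  formulations with rescaled bump functions concentrated at \<open>p\<close> and letting the scale tend to zero
  replaces the gradient by its one-sided limits \<open>G\<^sup>i\<close>, \<open>G\<^sup>e\<close>. The symmetry of second derivatives of the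
  bump then gives \<open>G\<^sup>i - G\<^sup>e = a \<otimes> n\<close>, and the elastic equation gives
  \<open>(\<C>\<^sup>i G\<^sup>i) n = (\<C>\<^sup>e G\<^sup>e) n\<close>. With both conditions for \<open>u\<close> and \<open>v\<close> the formula is linear algebra,
  because they say that \<open>a = Q ((\<C>\<^sup>e - \<C>\<^sup>i) G\<^sup>e n)\<close>, so that \<open>\<M> G\<^sup>e = (\<C>\<^sup>e - \<C>\<^sup>i) G\<^sup>i\<close>.
\<close>

section \<open>Algebra of the jump\<close>

text \<open>The weak formulation speaks of \<open>G\<close> only through integrals, whereas the
  claim concerns pointwise one-sided limits of the classical \<open>jacobian\<close>. The blow-up
  needs neither traces of \<open>u\<close> on the face nor surface integrals. Its only analytic
  input on the limit half space {y . n < 0} is that the derivative of the bump along v has integral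
  (v . n) times a positive constant, with the opposite sign on the complementary half space. Each
  test yields an exact identity between integrals over the two half balls; divided by the cube of
  the scale it has a finite limit, which is a linear relation between G^i and G^e, so no error
  estimates arise. The test functions do not vanish on the face. Identifying \<open>G\<close> with
  the \<open>jacobian\<close> inside one half ball therefore takes a second cut-off, removed by
  dominated convergence; the domination comes from the boundedness of the \<open>jacobian\<close>
  near p, a consequence of its having a limit there. That the two half balls lie in different phases
  has two sources: the outer normal settles one side, the Lipschitz condition on \<Omega> - D the
  other.\<close>

lemma linear_isotropic_tensor: "linear (isotropic_tensor mu lam)"
  by (rule linearI)
    (simp_all add: isotropic_tensor_def sym_part_def vec_eq_iff transpose_def trace_def mat_def
      sum.distrib sum_distrib_left algebra_simps)

lemmas isotropic_tensor_add = linear_add[OF linear_isotropic_tensor]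

lemma transpose_isotropic_tensor: "transpose (isotropic_tensor mu lam A) = isotropic_tensor mu lam A"
  by (simp add: isotropic_tensor_def sym_part_def vec_eq_iff transpose_def mat_def)

lemma isotropic_tensor_sym_part: "isotropic_tensor mu lam (sym_part A) = isotropic_tensor mu lam A"
proof -
  have "transpose (sym_part A) = sym_part A"
    by (simp add: sym_part_def vec_eq_iff transpose_def)
  then have "sym_part (sym_part A) = sym_part A"
    unfolding sym_part_def[of "sym_part A"] by (simp add: scaleR_half_double)
  moreover have "trace (sym_part A) = trace A"
    by (simp add: sym_part_def transpose_def trace_def)
  ultimately show ?thesis by (simp add: isotropic_tensor_def)
qed

lemma inner_sym_part:
  assumes "transpose S = S" shows "S \<bullet> sym_part A = S \<bullet> A"
proof -
  have "S \<bullet> transpose A = transpose S \<bullet> A"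
    unfolding inner_vec_def transpose_def by (simp add: sum_3)
  then show ?thesis using assms by (simp add: sym_part_def inner_add_right)
qed

text \<open>Major symmetry of the isotropic tensor. In \<open>jump_identity\<close> it turns the
  unknown stress of \<open>outer_prod a n\<close> into the traction of \<open>He\<close>.\<close>

lemma isotropic_tensor_commute:
  "isotropic_tensor mu lam A \<bullet> B = isotropic_tensor mu lam B \<bullet> A"
proof -
  have "isotropic_tensor mu lam A \<bullet> B = 2 * mu * (sym_part A \<bullet> sym_part B) + lam * trace A * trace B" for A B
  proof -
    have "transpose (sym_part A) = sym_part A"
      by (simp add: sym_part_def vec_eq_iff transpose_def)
    moreover have "mat 1 \<bullet> B = trace B"
      by (simp add: mat_def inner_vec_def trace_def sum_3)
    ultimately show ?thesis
      by (simp add: isotropic_tensor_def inner_add_left inner_sym_part)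
  qed
  then show ?thesis by (simp add: inner_commute)
qed

lemma inner_outer_prod: "S \<bullet> outer_prod a b = (S *v b) \<bullet> a"
  by (simp add: inner_vec_def outer_prod_def matrix_vector_mult_def sum_3 algebra_simps)

lemma outer_prod_mult_vec: "outer_prod a b *v x = (b \<bullet> x) *\<^sub>R a"
  by (simp add: vec_eq_iff inner_vec_def outer_prod_def matrix_vector_mult_def sum_3 algebra_simps)

lemma symmetric_inner_mult_vec:
  fixes S :: "real^'n^'n"
  assumes "transpose S = S" shows "(S *v x) \<bullet> y = (S *v y) \<bullet> x"
  using assms dot_lmul_matrix[of x S y] by (metis inner_commute transpose_matrix_vector)

section \<open>Inverse matrices and the acoustic tensor\<close>

lemma matrix_inv_inverse:
  assumes "invertible A"
  shows "A ** matrix_inv A = mat 1" "matrix_inv A ** A = mat 1"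
  using someI_ex[OF assms[unfolded invertible_def]] by (simp_all add: matrix_inv_def)

lemma invertible_matrix_inv: "invertible A \<Longrightarrow> invertible (matrix_inv A)"
  using matrix_inv_inverse unfolding invertible_def[of "matrix_inv A"] by blast

lemma matrix_inv_matrix_inv:
  assumes "invertible A" shows "matrix_inv (matrix_inv A) = A"
proof -
  have "matrix_inv (matrix_inv A) = (A ** matrix_inv A) ** matrix_inv (matrix_inv A)"
    by (simp add: matrix_inv_inverse assms)
  also have "\<dots> = A"
    unfolding matrix_mul_assoc[symmetric] by (simp add: matrix_inv_inverse invertible_matrix_inv assms)
  finally show ?thesis .
qed

text \<open>The map \<zeta> to C(\<zeta> \<otimes> n) n is the acoustic tensor, with matrix P =
  \<mu> I + (\<mu> + \<lambda>) n \<otimes> n. It is positive definite under the stated signs, hence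
  invertible, and the defining property of \<open>Q_matrix\<close> singles out its inverse. So
  \<open>Q_matrix\<close> recovers a from the traction of a \<otimes> n.\<close>

lemma Q_matrix_eq:
  assumes mu: "mu > 0" "mu + lam > 0" and n: "norm n = 1"
  shows "Q_matrix (isotropic_tensor mu lam) n *v (isotropic_tensor mu lam (outer_prod a n) *v n) = a"
proof -
  let ?C = "isotropic_tensor mu lam"
  define P where "P = matrix (\<lambda>\<zeta>. ?C (outer_prod \<zeta> n) *v n)"
  have lin: "linear (\<lambda>\<zeta>. ?C (outer_prod \<zeta> n) *v n)"
  proof -
    have "outer_prod (x + y) n = outer_prod x n + outer_prod y n"
      "outer_prod (k *\<^sub>R x) n = k *\<^sub>R outer_prod x n" for x y k
      by (simp_all add: outer_prod_def vec_eq_iff algebra_simps)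
    then show ?thesis
      by (intro linearI) (simp_all only: isotropic_tensor_add linear_scale[OF linear_isotropic_tensor]
          matrix_vector_mult_add_rdistrib scaleR_matrix_vector_assoc)
  qed
  have P: "P *v \<zeta> = ?C (outer_prod \<zeta> n) *v n" for \<zeta>
    unfolding P_def by (rule matrix_works) (simp only: linear_matrix_vector_mul_eq lin)
  have nn: "n \<bullet> n = 1" using n by (simp add: norm_eq_1)
  have Pform: "(P *v \<zeta>) \<bullet> \<zeta> = mu * (\<zeta> \<bullet> \<zeta>) + (mu + lam) * (\<zeta> \<bullet> n)\<^sup>2" for \<zeta>
  proof -
    \<comment> \<open>The factor \<open>n \<bullet> n\<close> stays symbolic, so that this is a
      polynomial identity checked entry by entry; the normalization of \<open>n\<close> enters only
      afterwards through \<open>nn\<close>.\<close>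
    have 1: "?C (outer_prod \<zeta> n) *v n = mu *\<^sub>R ((n \<bullet> n) *\<^sub>R \<zeta> + (\<zeta> \<bullet> n) *\<^sub>R n) + (lam * (\<zeta> \<bullet> n)) *\<^sub>R n"
      by (simp add: vec_eq_iff isotropic_tensor_def sym_part_def outer_prod_def matrix_vector_mult_def
          transpose_def trace_def mat_def inner_vec_def sum_3 forall_3 algebra_simps)
    show ?thesis unfolding P 1 nn
      by (simp add: inner_add_left inner_commute[of n] power2_eq_square algebra_simps)
  qed
  have "invertible P"
  proof -
    have "\<zeta> = 0" if "P *v \<zeta> = 0" for \<zeta>
    proof (rule ccontr)
      assume "\<zeta> \<noteq> 0"
      then have "mu * (\<zeta> \<bullet> \<zeta>) > 0" using mu by simp
      moreover have "(mu + lam) * (\<zeta> \<bullet> n)\<^sup>2 \<ge> 0" using mu by simp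
      ultimately show False using Pform[of \<zeta>] that by simp
    qed
    then show ?thesis
      using invertible_left_inverse matrix_left_invertible_ker by blast
  qed
  have "Q_matrix ?C n = matrix_inv P"
    unfolding Q_matrix_def
  proof (rule the_equality)
    show "invertible (matrix_inv P) \<and> (\<forall>\<zeta> \<eta>. (matrix_inv (matrix_inv P) *v \<zeta>) \<bullet> \<eta> = ?C (outer_prod \<zeta> n) \<bullet> outer_prod \<eta> n)"
      using \<open>invertible P\<close>
      by (simp add: P inner_outer_prod matrix_inv_matrix_inv invertible_matrix_inv)
  next
    fix Q assume Q: "invertible Q \<and> (\<forall>\<zeta> \<eta>. (matrix_inv Q *v \<zeta>) \<bullet> \<eta> = ?C (outer_prod \<zeta> n) \<bullet> outer_prod \<eta> n)"
    then have "(matrix_inv Q *v \<zeta>) \<bullet> \<eta> = (P *v \<zeta>) \<bullet> \<eta>" for \<zeta> \<eta>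
      by (simp add: P inner_outer_prod)
    then have "matrix_inv Q *v \<zeta> = P *v \<zeta>" for \<zeta>
      using vector_eq_rdot by blast
    then have "matrix_inv Q = P" by (simp add: matrix_eq)
    then show "Q = matrix_inv P" using Q matrix_inv_matrix_inv[of Q] by simp
  qed
  then show ?thesis
    using \<open>invertible P\<close> by (simp add: P[symmetric] matrix_vector_mul_assoc matrix_inv_inverse)
qed

text \<open>Write t_u, t_v for the tractions, which are the same on both sides. The gradients
  applied to w jump by (w . n) a and (w . n) c, so the left side is (w . n) times Ci Gi . Hi - Ce Ge
  . He - t_u . c - t_v . a. Since Ci Gi . Hi = Ci Gi . He + t_u . c, the vector c cancels. What
  remains is minus Ce Ge . He + t_v . a - Ci Gi . He, which is (Ce - Ci) Gi . He, that is, the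
  moment tensor term.\<close>

lemma jump_identity:
  fixes n :: "real^3"
  assumes mu: "mui > 0" "mui + lami > 0" and n: "norm n = 1"
    and Ci: "Ci = isotropic_tensor mui lami" and Ce: "Ce = isotropic_tensor mue lame"
    and Gi: "Gi = Ge + outer_prod a n" and Hi: "Hi = He + outer_prod c n"
    and su: "Ci Gi *v n = Ce Ge *v n" and sv: "Ci Hi *v n = Ce He *v n"
  shows "(((Ci Gi \<bullet> Hi) *\<^sub>R w - Ci Gi *v (Hi *v w) - Ci Hi *v (Gi *v w))
        - ((Ce Ge \<bullet> He) *\<^sub>R w - Ce Ge *v (He *v w) - Ce He *v (Ge *v w))) \<bullet> n
      = - (w \<bullet> n) * (moment_tensor Ci Ce n (sym_part Ge) \<bullet> sym_part He)"
proof -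
  have symi: "transpose (Ci A) = Ci A" and syme: "transpose (Ce A) = Ce A" for A
    by (simp_all add: Ci Ce transpose_isotropic_tensor)
  have addi: "Ci (A + B) = Ci A + Ci B" and adde: "Ce (A + B) = Ce A + Ce B" for A B
    by (simp_all add: Ci Ce isotropic_tensor_add)
  have "(Ci Ge + Ci (outer_prod a n)) *v n = Ce Ge *v n"
    using su by (simp only: Gi addi)
  then have e: "Ci (outer_prod a n) *v n = (Ce Ge - Ci Ge) *v n"
    by (simp only: matrix_vector_mult_add_rdistrib matrix_vector_mult_diff_rdistrib eq_diff_eq add.commute)
  have "Q_matrix Ci n *v (Ci (outer_prod a n) *v n) = a"
    unfolding Ci by (rule Q_matrix_eq[OF mu n])
  then have "Q_matrix Ci n *v ((Ce Ge - Ci Ge) *v n) = a" by (simp only: e)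
  then have M: "moment_tensor Ci Ce n (sym_part Ge) = Ce Gi - Ci Gi"
    by (simp add: moment_tensor_def Let_def Ci Ce isotropic_tensor_sym_part isotropic_tensor_add Gi)
  have "(Ce Gi - Ci Gi) \<bullet> sym_part He = (Ce Gi - Ci Gi) \<bullet> He"
    by (simp add: inner_diff_left inner_sym_part symi syme)
  also have "\<dots> = Ce Ge \<bullet> He + Ce (outer_prod a n) \<bullet> He - Ci Gi \<bullet> He"
    by (simp add: Gi adde inner_diff_left inner_add_left)
  also have "Ce (outer_prod a n) \<bullet> He = Ce He \<bullet> outer_prod a n"
    unfolding Ce by (rule isotropic_tensor_commute)
  also have "\<dots> = (Ce He *v n) \<bullet> a" by (rule inner_outer_prod)
  finally have R: "moment_tensor Ci Ce n (sym_part Ge) \<bullet> sym_part He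
      = Ce Ge \<bullet> He + (Ce He *v n) \<bullet> a - Ci Gi \<bullet> He" using M by simp
  \<comment> \<open>Stresses are symmetric, so pairing with n produces a traction; the traction
    conditions then express both phases through the exterior one.\<close>
  have b: "(Ci Gi *v x) \<bullet> n = (Ce Ge *v n) \<bullet> x" "(Ci Hi *v x) \<bullet> n = (Ce He *v n) \<bullet> x"
       "(Ce Ge *v x) \<bullet> n = (Ce Ge *v n) \<bullet> x" "(Ce He *v x) \<bullet> n = (Ce He *v n) \<bullet> x" for x
    by (simp_all only: symmetric_inner_mult_vec[OF symi, of _ x n] symmetric_inner_mult_vec[OF syme, of _ x n] su sv)
  have Gw: "Gi *v w = Ge *v w + (n \<bullet> w) *\<^sub>R a" "Hi *v w = He *v w + (n \<bullet> w) *\<^sub>R c"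
    by (simp_all add: Gi Hi matrix_vector_mult_add_rdistrib outer_prod_mult_vec)
  have "Ci Gi \<bullet> Hi = Ci Gi \<bullet> He + (Ce Ge *v n) \<bullet> c"
    by (simp add: Hi inner_add_right inner_outer_prod su)
  moreover have "(((Ci Gi \<bullet> Hi) *\<^sub>R w - Ci Gi *v (Hi *v w) - Ci Hi *v (Gi *v w))
        - ((Ce Ge \<bullet> He) *\<^sub>R w - Ce Ge *v (He *v w) - Ce He *v (Ge *v w))) \<bullet> n
      = ((Ci Gi \<bullet> Hi) * (w \<bullet> n) - (Ce Ge *v n) \<bullet> (Hi *v w) - (Ce He *v n) \<bullet> (Gi *v w))
        - ((Ce Ge \<bullet> He) * (w \<bullet> n) - (Ce Ge *v n) \<bullet> (He *v w) - (Ce He *v n) \<bullet> (Ge *v w))"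
    by (simp only: inner_diff_left inner_scaleR_left b)
  ultimately show ?thesis
    by (simp add: R Gw inner_add_right inner_commute[of n w] algebra_simps)
qed

section \<open>Elementary smooth functions\<close>

text \<open>The classical flat function exp(-1/x), carrying a polynomial factor in 1/x so that the
  family is closed under differentiation.\<close>

definition exp_flat :: "real poly \<Rightarrow> real \<Rightarrow> real" where
  "exp_flat P x = (if x > 0 then poly P (1 / x) * exp (- (1 / x)) else 0)"

text \<open>With t = 1/x, the derivative of P(t) exp(-t) in x is t^2 (P - P')(t) exp(-t), because
  dt/dx = -t^2.\<close>

definition exp_flat_deriv :: "real poly \<Rightarrow> real poly" where
  "exp_flat_deriv P = [:0, 0, 1:] * (P - pderiv P)"

lemma poly_times_exp_minus_tendsto_0: "((\<lambda>t. poly P t * exp (- t)) \<longlongrightarrow> (0::real)) at_top"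
proof -
  have "((\<lambda>t. coeff P i * t ^ i * exp (- t)) \<longlongrightarrow> (0::real)) at_top" for i
  proof -
    have "((\<lambda>t. t ^ i / exp t) \<longlongrightarrow> (0::real)) at_top" by (rule tendsto_power_div_exp_0)
    from tendsto_mult_left[OF this, of "coeff P i"] show ?thesis
      by (simp add: exp_minus field_simps)
  qed
  then have "((\<lambda>t. \<Sum>i\<le>degree P. coeff P i * t ^ i * exp (- t)) \<longlongrightarrow> (\<Sum>i\<le>degree P. 0)) at_top"
    by (intro tendsto_sum)
  then show ?thesis by (simp add: poly_altdef sum_distrib_right)
qed

lemma exp_flat_has_field_derivative:
  "(exp_flat P has_field_derivative exp_flat (exp_flat_deriv P) x) (at x)"
proof -
  consider "x > 0" | "x < 0" | "x = 0" by linarith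
  then show ?thesis
  proof cases
    case 1
    have "((\<lambda>x. poly P (1 / x) * exp (- (1 / x))) has_field_derivative
        poly (exp_flat_deriv P) (1 / x) * exp (- (1 / x))) (at x)"
      using 1 by (auto intro!: derivative_eq_intros simp: exp_flat_deriv_def field_simps power2_eq_square)
    then have "(exp_flat P has_field_derivative poly (exp_flat_deriv P) (1 / x) * exp (- (1 / x))) (at x)"
      by (rule has_field_derivative_transform_within_open[of _ _ _ "{0<..}"]) (use 1 in \<open>auto simp: exp_flat_def\<close>)
    then show ?thesis using 1 by (simp add: exp_flat_def)
  next
    case 2
    have "(exp_flat P has_field_derivative 0) (at x)"
      by (rule has_field_derivative_transform_within_open[of "\<lambda>_. 0" _ _ "{..<0}"]) (use 2 in \<open>auto simp: exp_flat_def\<close>)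
    then show ?thesis using 2 by (simp add: exp_flat_def)
  next
    case 3
    have "((\<lambda>h. exp_flat P h / h) \<longlongrightarrow> 0) (at_right 0)"
    proof -
      \<comment> \<open>The difference quotient at 0 carries a factor 1/h; it is absorbed into the
        polynomial, since \<open>pCons 0 P\<close> is t P(t).\<close>
      have "((\<lambda>h. poly (pCons 0 P) (inverse h) * exp (- inverse h)) \<longlongrightarrow> (0::real)) (at_right 0)"
        using filterlim_compose[OF poly_times_exp_minus_tendsto_0 filterlim_inverse_at_top_right] .
      then show ?thesis
        by (rule Lim_transform_eventually)
          (auto simp: eventually_at_filter exp_flat_def field_simps)
    qed
    moreover have "((\<lambda>h. exp_flat P h / h) \<longlongrightarrow> 0) (at_left 0)"
      by (rule Lim_transform_eventually[of "\<lambda>_. 0"]) (auto simp: eventually_at_filter exp_flat_def)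
    ultimately have "((\<lambda>h. exp_flat P h / h) \<longlongrightarrow> 0) (at 0)"
      by (simp add: filterlim_split_at)
    then show ?thesis using 3 by (simp add: DERIV_def exp_flat_def)
  qed
qed

text \<open>A class of functions that is closed under directional derivatives and contains all the cut-off
  functions below, so that smoothness never has to be checked by hand.\<close>

inductive elementary_smooth :: "('a::real_inner \<Rightarrow> real) \<Rightarrow> bool" where
  const: "elementary_smooth (\<lambda>x. c)"
| linear: "elementary_smooth (\<lambda>x. x \<bullet> v)"
| add: "elementary_smooth f \<Longrightarrow> elementary_smooth g \<Longrightarrow> elementary_smooth (\<lambda>x. f x + g x)"
| mult: "elementary_smooth f \<Longrightarrow> elementary_smooth g \<Longrightarrow> elementary_smooth (\<lambda>x. f x * g x)"
| flat: "elementary_smooth f \<Longrightarrow> elementary_smooth (\<lambda>x. exp_flat P (f x))"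

lemma elementary_smooth_sum:
  "(\<And>i. i \<in> I \<Longrightarrow> elementary_smooth (f i)) \<Longrightarrow> elementary_smooth (\<lambda>x. \<Sum>i\<in>I. f i x)"
  by (induction I rule: infinite_finite_induct) (auto intro: elementary_smooth.intros)

text \<open>The case that needs the polynomial parameter is \<open>flat\<close>: the chain rule
  gives \<open>exp_flat\<close> of another polynomial times a derivative of the inner function,
  again inside the class.\<close>

lemma elementary_smooth_derivative:
  assumes "elementary_smooth f"
  shows "\<exists>D. (\<forall>x. (f has_derivative D x) (at x)) \<and> (\<forall>v. elementary_smooth (\<lambda>x. D x v))"
  using assms
proof induction
  case (const c)
  then show ?case
    by (intro exI[of _ "\<lambda>x v. 0"]) (auto intro: elementary_smooth.intros)
next
  case (linear v)
  then show ?case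
    by (intro exI[of _ "\<lambda>x h. h \<bullet> v"]) (auto intro!: elementary_smooth.intros derivative_eq_intros)
next
  case (add f g)
  then obtain D E where "\<And>x. (f has_derivative D x) (at x)" "\<And>v. elementary_smooth (\<lambda>x. D x v)"
    "\<And>x. (g has_derivative E x) (at x)" "\<And>v. elementary_smooth (\<lambda>x. E x v)" by blast
  then show ?case
    by (intro exI[of _ "\<lambda>x v. D x v + E x v"]) (auto intro!: elementary_smooth.intros has_derivative_add)
next
  case (mult f g)
  then obtain D E where "\<And>x. (f has_derivative D x) (at x)" "\<And>v. elementary_smooth (\<lambda>x. D x v)"
    "\<And>x. (g has_derivative E x) (at x)" "\<And>v. elementary_smooth (\<lambda>x. E x v)" by blast
  then show ?case using mult.hyps
    by (intro exI[of _ "\<lambda>x v. f x * E x v + D x v * g x"]) (auto intro!: elementary_smooth.intros has_derivative_mult)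
next
  case (flat f P)
  then obtain D where D: "\<And>x. (f has_derivative D x) (at x)" "\<And>v. elementary_smooth (\<lambda>x. D x v)" by blast
  have "((\<lambda>x. exp_flat P (f x)) has_derivative (\<lambda>v. exp_flat (exp_flat_deriv P) (f x) * D x v)) (at x)" for x
    using has_derivative_compose[OF D(1) exp_flat_has_field_derivative[unfolded has_field_derivative_def]] by simp
  then show ?case using flat.hyps D
    by (intro exI[of _ "\<lambda>x v. exp_flat (exp_flat_deriv P) (f x) * D x v"]) (auto intro!: elementary_smooth.intros)
qed

lemma elementary_smooth_frechet:
  assumes "elementary_smooth f"
  shows "(f has_derivative frechet_derivative f (at x)) (at x)"
    and "elementary_smooth (\<lambda>x. frechet_derivative f (at x) v)"
proof -
  obtain D where D: "\<And>x. (f has_derivative D x) (at x)" "\<And>v. elementary_smooth (\<lambda>x. D x v)"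
    using elementary_smooth_derivative[OF assms] by blast
  then have "frechet_derivative f (at x) = D x" for x
    using frechet_derivative_at[OF D(1)] by simp
  then show "(f has_derivative frechet_derivative f (at x)) (at x)"
    "elementary_smooth (\<lambda>x. frechet_derivative f (at x) v)" using D by auto
qed

lemma elementary_smooth_continuous: "elementary_smooth f \<Longrightarrow> continuous_on S f"
  using elementary_smooth_frechet(1) by (metis continuous_at_imp_continuous_on has_derivative_continuous)

text \<open>The constant factor \<open>v\<close> covers scalar test functions (v = 1) and vector
  ones (v a coordinate vector) together. Since a directional derivative has the same shape with a
  new \<open>f\<close>, the induction on the order generalizes over \<open>f\<close>.\<close>

lemma smooth_upto_elementary_smooth:
  fixes f :: "real^3 \<Rightarrow> real" and v :: "'b::real_normed_vector"
  assumes "elementary_smooth f"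
  shows "smooth_upto UNIV {} (\<lambda>x. f x *\<^sub>R v)"
proof -
  have "Ck_upto k UNIV {} (\<lambda>x. f x *\<^sub>R v)" for k
    using assms
  proof (induction k arbitrary: f)
    case 0
    then show ?case
      by (auto simp: extends_continuously_def intro!: continuous_intros elementary_smooth_continuous
          exI[of _ "\<lambda>x. f x *\<^sub>R v"])
  next
    case (Suc k)
    have der: "((\<lambda>x. f x *\<^sub>R v) has_derivative (\<lambda>h. frechet_derivative f (at x) h *\<^sub>R v)) (at x)" for x
      by (intro has_derivative_scaleR_left elementary_smooth_frechet Suc.prems)
    have "frechet_derivative (\<lambda>x. f x *\<^sub>R v) (at x) w = frechet_derivative f (at x) w *\<^sub>R v" for x w
      using frechet_derivative_at[OF der] by metis
    moreover have "extends_continuously UNIV {} (\<lambda>x. f x *\<^sub>R v)"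
      using Suc.prems by (auto simp: extends_continuously_def intro!: continuous_intros elementary_smooth_continuous
          exI[of _ "\<lambda>x. f x *\<^sub>R v"])
    moreover have "(\<lambda>x. f x *\<^sub>R v) differentiable_on UNIV"
      using der by (auto simp: differentiable_on_def differentiable_def)
    ultimately show ?case
      using Suc.IH[OF elementary_smooth_frechet(2)[OF Suc.prems]] by simp
  qed
  then show ?thesis by (simp add: smooth_upto_def)
qed

lemma test_function_elementary_smooth:
  fixes f :: "real^3 \<Rightarrow> real" and v :: "'b::real_normed_vector"
  assumes "elementary_smooth f" "{x. f x \<noteq> 0} \<subseteq> K" "compact K" "K \<subseteq> \<Omega>"
  shows "test_function \<Omega> (\<lambda>x. f x *\<^sub>R v)"
proof -
  have "closure {x. f x *\<^sub>R v \<noteq> 0} \<subseteq> K"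
    using assms by (intro closure_minimal compact_imp_closed) auto
  moreover from this have "compact (closure {x. f x *\<^sub>R v \<noteq> 0})"
    using assms by (meson closed_closure compact_Int_closed compact_closure compact_imp_bounded bounded_subset closure_subset)
  ultimately show ?thesis
    using assms smooth_upto_elementary_smooth[OF assms(1)] by (auto simp: test_function_def)
qed

section \<open>Weak and classical gradients on a half ball\<close>

lemma integral_lborel_affine:
  fixes f :: "'a::euclidean_space \<Rightarrow> 'b::{banach, second_countable_topology}"
  assumes [measurable]: "f \<in> borel_measurable borel" and c: "c \<noteq> 0"
  shows "(\<integral>x. f x \<partial>lborel) = \<bar>c\<bar> ^ DIM('a) *\<^sub>R (\<integral>x. f (t + c *\<^sub>R x) \<partial>lborel)"
  by (subst lborel_affine[OF c, of t]) (simp add: integral_density integral_distr)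

text \<open>The difference quotients of \<open>w\<close> along \<open>v\<close> integrate to zero over a set that is invariant
  under translations along \<open>v\<close>.\<close>

lemma integral_directional_derivative_eq_0:
  fixes w :: "'a::euclidean_space \<Rightarrow> real"
  assumes der: "\<And>x. (w has_derivative D x) (at x)"
    and bound: "\<And>x. \<bar>D x v\<bar> \<le> M"
    and supp: "{x. w x \<noteq> 0} \<subseteq> cball 0 R"
    and S: "S \<in> sets borel" and inv: "\<And>x t. x + t *\<^sub>R v \<in> S \<longleftrightarrow> x \<in> S"
  shows "(LINT x:S|lborel. D x v) = 0"
proof -
  have wcont: "continuous_on UNIV w"
    using der by (meson continuous_at_imp_continuous_on has_derivative_continuous)
  have [measurable]: "w \<in> borel_measurable borel" by (rule borel_measurable_continuous_onI[OF wcont])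
  note [measurable] = S
  have suppD: "w x = 0" if "norm x > R" for x using supp that by fastforce
  define t where "t k = 1 / real (Suc k)" for k
  have t: "t k > 0" "t k \<le> 1" for k by (auto simp: t_def)
  have "t \<longlonglongrightarrow> 0" unfolding t_def by (rule LIMSEQ_Suc[OF lim_1_over_n])
  define q where "q k x = indicator S x *\<^sub>R ((w (x + t k *\<^sub>R v) - w x) / t k)" for k x
  have M: "M \<ge> 0" using bound abs_ge_zero order_trans by blast
  have qlim: "(\<lambda>k. q k x) \<longlonglongrightarrow> indicator S x *\<^sub>R D x v" for x
  proof -
    have "((\<lambda>s. w (x + s *\<^sub>R v)) has_derivative (\<lambda>s. D x (s *\<^sub>R v))) (at 0)"
      by (rule has_derivative_compose[of "\<lambda>s. x + s *\<^sub>R v" "\<lambda>s. s *\<^sub>R v" 0 UNIV w "D x", simplified])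
        (auto intro!: derivative_eq_intros der)
    moreover have "(\<lambda>s. D x (s *\<^sub>R v)) = (*) (D x v)"
      using has_derivative_linear[OF der[of x]] by (auto simp: linear_scale)
    ultimately have "((\<lambda>s. w (x + s *\<^sub>R v)) has_field_derivative D x v) (at 0)"
      by (simp add: has_field_derivative_def)
    then have "((\<lambda>h. (w (x + h *\<^sub>R v) - w x) / h) \<longlongrightarrow> D x v) (at 0)"
      by (simp add: DERIV_def)
    moreover have "filterlim t (at 0) sequentially"
      using \<open>t \<longlonglongrightarrow> 0\<close> t by (auto simp: filterlim_at less_le eventually_sequentially)
    ultimately have "(\<lambda>k. (w (x + t k *\<^sub>R v) - w x) / t k) \<longlonglongrightarrow> D x v"
      by (rule filterlim_compose)
    then show ?thesis unfolding q_def by (intro tendsto_intros)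
  qed
  \<comment> \<open>A step \<open>t k \<le> 1\<close> moves a point by at most
    \<open>norm v\<close>. Beyond radius R + \<open>norm v\<close> both values of \<open>w\<close>
    therefore vanish, and elsewhere the mean value theorem bounds the quotient by M.\<close>
  have qbound: "norm (q k x) \<le> M * indicator (cball 0 (R + norm v)) x" for k x
  proof (cases "norm x > R + norm v")
    case True
    have "norm (x + t k *\<^sub>R v) \<ge> norm x - norm (t k *\<^sub>R v)" by (rule norm_diff_ineq)
    moreover have "norm (t k *\<^sub>R v) \<le> norm v" using t[of k] by (simp add: mult_left_le_one_le)
    ultimately have "norm (x + t k *\<^sub>R v) > R" using True by linarith
    moreover have "norm x > R" using True by (smt (verit) norm_ge_zero)
    ultimately show ?thesis using M by (simp add: q_def suppD)
  next
    case False
    have "\<exists>s\<in>{0<..<t k}. w (x + t k *\<^sub>R v) - w (x + 0 *\<^sub>R v) = D (x + s *\<^sub>R v) (t k *\<^sub>R v - 0 *\<^sub>R v)"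
    proof -
      have d: "((\<lambda>s. w (x + s *\<^sub>R v)) has_derivative (\<lambda>h. D (x + s *\<^sub>R v) (h *\<^sub>R v))) (at s)" for s
        by (rule has_derivative_compose[of "\<lambda>s. x + s *\<^sub>R v" "\<lambda>s. s *\<^sub>R v" s UNIV w "D (x + s *\<^sub>R v)", simplified])
          (auto intro!: derivative_eq_intros der)
      obtain s where "s \<in> {0<..<t k}" "w (x + t k *\<^sub>R v) - w (x + 0 *\<^sub>R v) = D (x + s *\<^sub>R v) ((t k - 0) *\<^sub>R v)"
        using mvt_simple[OF t(1)[of k], of "\<lambda>s. w (x + s *\<^sub>R v)" "\<lambda>s h. D (x + s *\<^sub>R v) (h *\<^sub>R v)"]
          has_derivative_at_withinI[OF d] by metis
      then show ?thesis by auto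
    qed
    then obtain s where "w (x + t k *\<^sub>R v) - w x = t k * D (x + s *\<^sub>R v) v"
      using linear_scale[OF has_derivative_linear[OF der]] by fastforce
    then have "(w (x + t k *\<^sub>R v) - w x) / t k = D (x + s *\<^sub>R v) v" using t[of k] by simp
    then show ?thesis using bound M False by (simp add: q_def indicator_def)
  qed
  have intw: "integrable lborel (\<lambda>x. indicator S x *\<^sub>R w x)"
  proof -
    have "integrable lborel (\<lambda>x. indicator (cball 0 R) x *\<^sub>R w x)"
      by (rule borel_integrable_compact) (auto intro: continuous_on_subset[OF wcont])
    then have "integrable lborel (\<lambda>x. indicator S x *\<^sub>R (indicator (cball 0 R) x *\<^sub>R w x))"
      by (rule integrable_mult_indicator[rotated]) auto
    moreover have "indicator (cball 0 R) x *\<^sub>R w x = w x" for x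
      using suppD[of x] by (auto simp: indicator_def)
    ultimately show ?thesis by (simp only:)
  qed
  \<comment> \<open>Lebesgue measure and S are both invariant under translation along
    \<open>v\<close>, so the shifted integral is the original one and every quotient
    \<open>q k\<close> integrates to 0.\<close>
  have trans: "has_bochner_integral lborel (\<lambda>x. indicator S x *\<^sub>R w (x + s *\<^sub>R v)) (LINT x:S|lborel. w x)" for s
  proof -
    have "has_bochner_integral lborel (\<lambda>x. indicator S x *\<^sub>R w x) (LINT x:S|lborel. w x)"
      using intw by (simp add: has_bochner_integral_iff set_lebesgue_integral_def)
    then have "has_bochner_integral (distr lborel borel ((+) (s *\<^sub>R v))) (\<lambda>x. indicator S x *\<^sub>R w x) (LINT x:S|lborel. w x)"
      by (simp add: lborel_distr_plus)
    then have "has_bochner_integral lborel (\<lambda>x. indicator S (s *\<^sub>R v + x) *\<^sub>R w (s *\<^sub>R v + x)) (LINT x:S|lborel. w x)"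
      by (subst (asm) has_bochner_integral_iff, simp add: integrable_distr_eq integral_distr has_bochner_integral_iff)
    moreover have "indicator S (s *\<^sub>R v + x) = (indicator S x :: real)" for x
      using inv[of x s] by (simp add: indicator_def add.commute)
    ultimately show ?thesis by (simp add: add.commute)
  qed
  have "(\<integral>x. q k x \<partial>lborel) = 0" for k
  proof -
    have "has_bochner_integral lborel (\<lambda>x. (indicator S x *\<^sub>R w (x + t k *\<^sub>R v) - indicator S x *\<^sub>R w (x + 0 *\<^sub>R v)) / t k)
       (((LINT x:S|lborel. w x) - (LINT x:S|lborel. w x)) / t k)"
      by (intro has_bochner_integral_divide_zero has_bochner_integral_diff trans)
    then show ?thesis
      by (simp add: q_def has_bochner_integral_iff diff_divide_distrib right_diff_distrib)
  qed
  moreover have qm: "q k \<in> borel_measurable lborel" for k unfolding q_def by measurable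
  have "(\<lambda>k. \<integral>x. q k x \<partial>lborel) \<longlonglongrightarrow> (\<integral>x. indicator S x *\<^sub>R D x v \<partial>lborel)"
  proof (rule integral_dominated_convergence)
    show "(\<lambda>x. indicator S x *\<^sub>R D x v) \<in> borel_measurable lborel"
      by (rule borel_measurable_LIMSEQ_metric[OF qm qlim])
    show "q k \<in> borel_measurable lborel" for k by (rule qm)
    show "integrable lborel (\<lambda>x. M * indicator (cball 0 (R + norm v)) x)"
      using emeasure_bounded_finite[of "cball 0 (R + norm v)"]
      by (intro integrable_mult_right integrable_real_indicator) auto
  qed (use qlim qbound in auto)
  ultimately show ?thesis by (simp add: set_lebesgue_integral_def LIMSEQ_const_iff)
qed

text \<open>The flat side is left out, so the set is open and does not contain \<open>p\<close>. The
  opposite half is \<open>half_ball p (- n) r\<close>, which lets one statement serve both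
  sides.\<close>

definition half_ball :: "'a::real_inner \<Rightarrow> 'a \<Rightarrow> real \<Rightarrow> 'a set" where
  "half_ball p n r = ball p r \<inter> {x. (x - p) \<bullet> n < 0}"

lemma open_half_ball: "open (half_ball p n r)"
  unfolding half_ball_def by (intro open_Int open_ball open_Collect_less continuous_intros)

lemma half_ball_borel [measurable]: "half_ball p n r \<in> sets borel"
  using open_half_ball by (rule borel_open)

lemma elementary_smooth_affine:
  assumes "elementary_smooth f" shows "elementary_smooth (\<lambda>x. f (c *\<^sub>R (x - p)))"
  using assms
proof induction
  case (linear v)
  have "(\<lambda>x. c *\<^sub>R (x - p) \<bullet> v) = (\<lambda>x. c * (x \<bullet> v) + - c * (p \<bullet> v))"
    by (simp add: inner_diff_left algebra_simps)
  moreover have "elementary_smooth (\<lambda>x. c * (x \<bullet> v) + - c * (p \<bullet> v))"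
    by (intro elementary_smooth.intros)
  ultimately show ?case by simp
qed (auto intro: elementary_smooth.intros)

lemma jacobian_entry: "jacobian u F $ i $ j = frechet_derivative u F (axis j 1) $ i"
  by (simp add: jacobian_def matrix_def)

text \<open>For a cut-off \<eta> compactly supported in P, the product u_i \<eta> extended by 0 is
  differentiable on the whole space, and its j-th derivative has integral 0. This is classical
  integration by parts, and comparing it with the weak one for the test function \<eta> leaves the
  two gradients tested against \<eta>.\<close>

lemma weak_gradient_eq_jacobian:
  fixes \<eta> :: "real^3 \<Rightarrow> real"
  assumes wg: "weak_gradient \<Omega> u G" and P: "open P" "P \<subseteq> \<Omega>"
    and diff: "u differentiable_on P" and cont: "continuous_on P (\<lambda>x. jacobian u (at x))"
    and \<eta>: "elementary_smooth \<eta>" and K: "{x. \<eta> x \<noteq> 0} \<subseteq> K" "compact K" "K \<subseteq> P"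
  shows "(LINT x:P|lebesgue. \<eta> x * G x $ i $ j) = (LINT x:P|lebesgue. \<eta> x * jacobian u (at x) $ i $ j)"
proof -
  define d where "d x = frechet_derivative \<eta> (at x) (axis j 1)" for x
  define g where "g x = indicator P x *\<^sub>R (\<eta> x * jacobian u (at x) $ i $ j)" for x
  define h where "h x = indicator P x *\<^sub>R (u x $ i * d x)" for x
  have \<eta>0: "\<eta> x = 0" if "x \<notin> K" for x using K that by auto
  have "open (- K)" using K compact_imp_closed by blast
  have \<eta>der: "(\<eta> has_derivative frechet_derivative \<eta> (at x)) (at x)" for x
    by (rule elementary_smooth_frechet[OF \<eta>])
  have out: "(\<eta> has_derivative (\<lambda>_. 0)) (at x)" if "x \<notin> K" for x
    by (rule has_derivative_transform_within_open[of "\<lambda>_. 0" _ _ _ "- K"])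
      (use that \<eta>0 \<open>open (- K)\<close> in auto)
  have d0: "d x = 0" if "x \<notin> K" for x
    using has_derivative_unique[OF \<eta>der out[OF that]] by (simp add: d_def)
  have udiff: "u differentiable (at x)" if "x \<in> P" for x
    using diff P that by (simp add: differentiable_on_eq_differentiable_at)
  have ucont: "continuous_on P u" using diff by (rule differentiable_imp_continuous_on)
  have dcont: "continuous_on S d" for S
    unfolding d_def by (intro elementary_smooth_continuous elementary_smooth_frechet \<eta>)
  \<comment> \<open>The total derivative of the product. The value 0 outside P is correct because
    \<eta> vanishes in a neighbourhood of every point outside K.\<close>
  define D where "D x v = (if x \<in> P then u x $ i * frechet_derivative \<eta> (at x) v
      + (jacobian u (at x) *v v) $ i * \<eta> x else 0)" for x v
  have der: "((\<lambda>x. u x $ i * \<eta> x) has_derivative D x) (at x)" for x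
  proof (cases "x \<in> P")
    case True
    have "((\<lambda>x. u x $ i) has_derivative (\<lambda>v. (jacobian u (at x) *v v) $ i)) (at x)"
      using udiff[OF True] unfolding jacobian_works
      by (rule bounded_linear.has_derivative[OF bounded_linear_vec_nth])
    from has_derivative_mult[OF this \<eta>der] True show ?thesis
      by (simp add: D_def[abs_def])
  next
    case False
    then have "x \<notin> K" using K by auto
    have "((\<lambda>x. u x $ i * \<eta> x) has_derivative (\<lambda>_. 0)) (at x)"
      by (rule has_derivative_transform_within_open[of "\<lambda>_. 0" _ _ _ "- K"])
        (use \<open>x \<notin> K\<close> \<eta>0 \<open>open (- K)\<close> in auto)
    then show ?thesis using False by (simp add: D_def[abs_def])
  qed
  have D_eq: "D x (axis j 1) = h x + g x" for x
    by (simp add: D_def h_def g_def d_def matrix_vector_mult_basis column_def)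
  have contK: "continuous_on K (\<lambda>x. \<eta> x * jacobian u (at x) $ i $ j)"
    by (intro continuous_intros elementary_smooth_continuous[OF \<eta>] continuous_on_subset[OF cont K(3)])
  have contK2: "continuous_on K (\<lambda>x. u x $ i * d x)"
    by (intro continuous_intros dcont continuous_on_subset[OF ucont K(3)])
  \<comment> \<open>Passing from P to the compact set K gives integrability and boundedness from
    continuity alone, without control of \<open>u\<close> near the boundary of P.\<close>
  have gK: "g = (\<lambda>x. indicator K x *\<^sub>R (\<eta> x * jacobian u (at x) $ i $ j))"
    using \<eta>0 K by (force simp: g_def indicator_def)
  have hK: "h = (\<lambda>x. indicator K x *\<^sub>R (u x $ i * d x))"
    using d0 K by (force simp: h_def indicator_def)
  have int: "integrable lborel g" "integrable lborel h"
    unfolding gK hK by (intro borel_integrable_compact K contK contK2)+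
  have meas: "g \<in> borel_measurable lborel" "h \<in> borel_measurable lborel"
    using int by auto
  obtain M1 where M1: "\<And>x. x \<in> K \<Longrightarrow> norm (\<eta> x * jacobian u (at x) $ i $ j) \<le> M1"
    using compact_imp_bounded[OF compact_continuous_image[OF contK K(2)]] by (auto simp: bounded_iff)
  obtain M2 where M2: "\<And>x. x \<in> K \<Longrightarrow> norm (u x $ i * d x) \<le> M2"
    using compact_imp_bounded[OF compact_continuous_image[OF contK2 K(2)]] by (auto simp: bounded_iff)
  obtain R where "\<forall>y\<in>K. dist 0 y \<le> R"
    using compact_imp_bounded[OF K(2)] unfolding bounded_any_center[of _ 0] by blast
  then have R: "K \<subseteq> cball 0 R" by (simp add: subset_iff)
  have "(LINT x:UNIV|lborel. D x (axis j 1)) = 0"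
  proof (rule integral_directional_derivative_eq_0[OF der])
    show "\<bar>D x (axis j 1)\<bar> \<le> \<bar>M1\<bar> + \<bar>M2\<bar>" for x
      unfolding D_eq gK hK using M1[of x] M2[of x] by (auto simp: indicator_def)
    show "{x. u x $ i * \<eta> x \<noteq> 0} \<subseteq> cball 0 R" using R K by auto
  qed auto
  then have sum0: "(\<integral>x. h x \<partial>lborel) + (\<integral>x. g x \<partial>lborel) = 0"
    unfolding D_eq using int by (simp add: set_lebesgue_integral_def)
  have "test_function \<Omega> \<eta>"
    using test_function_elementary_smooth[OF \<eta> K(1,2), of \<Omega> "1::real"] K P by auto
  then have "(LINT x:\<Omega>|lebesgue. u x $ i * d x) = - (LINT x:\<Omega>|lebesgue. G x $ i $ j * \<eta> x)"
    using wg by (simp add: weak_gradient_def d_def)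
  moreover have "(LINT x:\<Omega>|lebesgue. u x $ i * d x) = (\<integral>x. h x \<partial>lebesgue)"
    unfolding set_lebesgue_integral_def
    by (rule Bochner_Integration.integral_cong) (use d0 K P in \<open>auto simp: h_def indicator_def\<close>)
  moreover have "(LINT x:\<Omega>|lebesgue. G x $ i $ j * \<eta> x) = (LINT x:P|lebesgue. \<eta> x * G x $ i $ j)"
    unfolding set_lebesgue_integral_def
    by (rule Bochner_Integration.integral_cong) (use \<eta>0 K P in \<open>auto simp: indicator_def\<close>)
  moreover have "(LINT x:P|lebesgue. \<eta> x * jacobian u (at x) $ i $ j) = (\<integral>x. g x \<partial>lborel)"
    unfolding set_lebesgue_integral_def g_def[symmetric] by (rule integral_completion[OF meas(1)])
  ultimately show ?thesis
    using sum0 integral_completion[OF meas(2)] by linarith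
qed

lemma exp_flat_1_bounds: "0 \<le> exp_flat 1 x" "exp_flat 1 x \<le> 1"
  by (auto simp: exp_flat_def)

lemma set_integrable_elementary_smooth_scaleR:
  fixes G :: "real^3 \<Rightarrow> 'b::euclidean_space"
  assumes \<eta>: "elementary_smooth \<eta>" and K: "{x. \<eta> x \<noteq> 0} \<subseteq> K" "compact K"
    and G: "set_integrable lebesgue K G" and P: "P \<in> sets lebesgue"
  shows "set_integrable lebesgue P (\<lambda>x. \<eta> x *\<^sub>R G x)"
proof -
  have cont: "continuous_on UNIV \<eta>" by (rule elementary_smooth_continuous[OF \<eta>])
  have [measurable]: "\<eta> \<in> borel_measurable lebesgue"
    using borel_measurable_continuous_onI[OF cont] by (simp add: measurable_completion)
  obtain B where B: "\<And>x. x \<in> K \<Longrightarrow> norm (\<eta> x) \<le> B"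
    using compact_imp_bounded[OF compact_continuous_image[OF continuous_on_subset[OF cont] K(2)]]
    by (auto simp: bounded_iff)
  have G': "integrable lebesgue (\<lambda>x. indicator K x *\<^sub>R G x)" using G by (simp add: set_integrable_def)
  have "integrable lebesgue (\<lambda>x. \<eta> x *\<^sub>R (indicator K x *\<^sub>R G x))"
  proof (rule Bochner_Integration.integrable_bound[OF integrable_scaleR_right[OF G', of B]])
    show "(\<lambda>x. \<eta> x *\<^sub>R indicator K x *\<^sub>R G x) \<in> borel_measurable lebesgue"
      using G' by measurable
    show "AE x in lebesgue. norm (\<eta> x *\<^sub>R indicator K x *\<^sub>R G x) \<le> norm (B *\<^sub>R (indicator K x *\<^sub>R G x))"
      using B by (intro AE_I2) (fastforce simp: indicator_def intro!: mult_right_mono)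
  qed
  moreover have "\<eta> x *\<^sub>R (indicator K x *\<^sub>R G x) = \<eta> x *\<^sub>R G x" for x
    using K by (auto simp: indicator_def)
  ultimately have "integrable lebesgue (\<lambda>x. \<eta> x *\<^sub>R G x)" by (simp only:)
  with P show ?thesis unfolding set_integrable_def by (rule integrable_mult_indicator)
qed

lemma bounded_linear_matrix_entry: "bounded_linear (\<lambda>A::real^'n^'m. A $ i $ j)"
  by (rule bounded_linear_compose[OF bounded_linear_vec_nth bounded_linear_vec_nth])

lemma weak_gradient_integrable:
  "weak_gradient \<Omega> u G \<Longrightarrow> compact K \<Longrightarrow> K \<subseteq> \<Omega> \<Longrightarrow> set_integrable lebesgue K G"
  by (simp add: weak_gradient_def)

text \<open>Here \<eta> may be nonzero up to the flat side, so its support need not be compact in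
  the half ball. Multiplying by cut-offs \<theta>_k that vanish near the plane reduces to the
  previous case, and dominated convergence removes them: \<eta> G is integrable by local
  integrability of \<open>G\<close>, and \<eta> times the \<open>jacobian\<close> because of the
  bound M.\<close>

lemma weak_gradient_eq_jacobian_half_ball:
  fixes \<eta> :: "real^3 \<Rightarrow> real"
  assumes wg: "weak_gradient \<Omega> u G" and r: "ball p r \<subseteq> \<Omega>" "s < r"
    and diff: "u differentiable_on half_ball p n r"
    and cont: "continuous_on (half_ball p n r) (\<lambda>x. jacobian u (at x))"
    and bound: "\<And>x. x \<in> half_ball p n r \<inter> cball p s \<Longrightarrow> norm (jacobian u (at x)) \<le> M"
    and \<eta>: "elementary_smooth \<eta>" and supp: "{x. \<eta> x \<noteq> 0} \<subseteq> cball p s"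
  shows "(LINT x:half_ball p n r|lebesgue. \<eta> x *\<^sub>R G x)
       = (LINT x:half_ball p n r|lborel. \<eta> x *\<^sub>R jacobian u (at x))"
proof -
  let ?P = "half_ball p n r"
  \<comment> \<open>The argument is positive exactly where (x - p) . n < -1/(k + 1), which keeps the
    support off the plane. At a fixed point of the half ball it tends to infinity, where
    \<open>exp_flat 1\<close> tends to 1.\<close>
  define \<theta> where "\<theta> k x = exp_flat 1 (- real (Suc k) * ((x - p) \<bullet> n) - 1)" for k x
  have \<theta>: "elementary_smooth (\<theta> k)" for k
  proof -
    have "elementary_smooth (\<lambda>x. exp_flat 1 ((- real (Suc k)) * (x \<bullet> n) + (real (Suc k) * (p \<bullet> n) - 1)))"
      by (intro elementary_smooth.intros)
    then show ?thesis by (simp add: \<theta>_def[abs_def] inner_diff_left algebra_simps)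
  qed
  have \<theta>_lim: "(\<lambda>k. \<theta> k x) \<longlonglongrightarrow> 1" if "x \<in> ?P" for x
  proof -
    define c where "c = - ((x - p) \<bullet> n)"
    have "c > 0" using that by (simp add: c_def half_ball_def)
    then have "filterlim (\<lambda>k. real (Suc k) * c - 1) at_top sequentially" by real_asymp
    moreover have "((\<lambda>y. exp_flat 1 y) \<longlongrightarrow> 1) at_top"
    proof (rule Lim_transform_eventually)
      show "((\<lambda>y::real. exp (- (1 / y))) \<longlongrightarrow> 1) at_top" by real_asymp
      show "\<forall>\<^sub>F y::real in at_top. exp (- (1 / y)) = exp_flat 1 y"
        using eventually_gt_at_top[of 0] by eventually_elim (simp add: exp_flat_def)
    qed
    ultimately have "(\<lambda>k. exp_flat 1 (real (Suc k) * c - 1)) \<longlonglongrightarrow> 1"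
      using filterlim_compose by blast
    moreover have "\<theta> k x = exp_flat 1 (real (Suc k) * c - 1)" for k
      by (simp only: \<theta>_def c_def mult_minus_left mult_minus_right)
    ultimately show ?thesis by simp
  qed
  have \<theta>_bd: "0 \<le> \<theta> k x" "\<theta> k x \<le> 1" for k x by (simp_all add: \<theta>_def exp_flat_1_bounds)
  have P: "open ?P" "?P \<subseteq> \<Omega>" using r open_half_ball by (auto simp: half_ball_def)
  have Pm: "?P \<in> sets lebesgue" using half_ball_borel by simp
  have J_borel: "(\<lambda>x. indicator ?P x *\<^sub>R jacobian u (at x)) \<in> borel_measurable borel"
    using borel_measurable_continuous_on_indicator[OF half_ball_borel cont] .
  have \<eta>m: "f \<in> borel_measurable borel" if "elementary_smooth f" for f :: "real^3 \<Rightarrow> real"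
    using borel_measurable_continuous_onI[OF elementary_smooth_continuous[OF that]] .
  obtain B where B: "\<And>x. x \<in> cball p s \<Longrightarrow> norm (\<eta> x) \<le> B"
    using compact_imp_bounded[OF compact_continuous_image[OF elementary_smooth_continuous[OF \<eta>] compact_cball]]
    unfolding bounded_iff by blast
  have "cball p s \<subseteq> ball p r" using r(2) by auto
  then have "cball p s \<subseteq> \<Omega>" using r(1) by (rule subset_trans)
  then have intG: "set_integrable lebesgue (cball p s) G"
    by (rule weak_gradient_integrable[OF wg compact_cball])
  have I1: "set_integrable lebesgue ?P (\<lambda>x. \<eta> x *\<^sub>R G x)"
    by (rule set_integrable_elementary_smooth_scaleR[OF \<eta> supp compact_cball intG Pm])
  define J where "J x = indicator ?P x *\<^sub>R (\<eta> x *\<^sub>R jacobian u (at x))" for x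
  have Jm: "J \<in> borel_measurable borel"
  proof -
    have "(\<lambda>x. \<eta> x *\<^sub>R (indicator ?P x *\<^sub>R jacobian u (at x))) \<in> borel_measurable borel"
      by (intro borel_measurable_scaleR \<eta>m[OF \<eta>] J_borel)
    moreover have "J = (\<lambda>x. \<eta> x *\<^sub>R (indicator ?P x *\<^sub>R jacobian u (at x)))"
      by (simp add: J_def fun_eq_iff)
    ultimately show ?thesis by (simp only:)
  qed
  have Jb: "norm (J x) \<le> \<bar>B\<bar> * \<bar>M\<bar> * indicator (cball p s) x" for x
  proof (cases "x \<in> ?P \<inter> cball p s")
    case True
    then have "norm (\<eta> x) * norm (jacobian u (at x)) \<le> \<bar>B\<bar> * \<bar>M\<bar>"
      using B[of x] bound[of x] by (intro mult_mono) auto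
    then show ?thesis using True by (simp add: J_def)
  next
    case False
    moreover have "\<eta> x = 0" if "x \<notin> cball p s" using supp that by blast
    ultimately have "J x = 0" by (cases "x \<in> ?P") (auto simp: J_def)
    then show ?thesis by simp
  qed
  have Jint: "integrable lborel J"
    by (rule Bochner_Integration.integrable_bound[of _ "\<lambda>x. \<bar>B\<bar> * \<bar>M\<bar> * indicator (cball p s) x"])
      (use Jm Jb emeasure_bounded_finite[of "cball p s"] in \<open>auto intro!: integrable_mult_right integrable_real_indicator\<close>)
  then have Jint': "integrable lebesgue J" using Jm by (simp add: integrable_completion)
  note comp = bounded_linear_matrix_entry
  have step: "(LINT x:?P|lebesgue. (\<theta> k x * \<eta> x) * G x $ i $ j)
     = (LINT x:?P|lebesgue. (\<theta> k x * \<eta> x) * jacobian u (at x) $ i $ j)" for k i j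
  proof (rule weak_gradient_eq_jacobian[OF wg P diff cont])
    show "elementary_smooth (\<lambda>x. \<theta> k x * \<eta> x)" by (intro elementary_smooth.intros \<theta> \<eta>)
    let ?K = "cball p s \<inter> {x. (x - p) \<bullet> n \<le> - (1 / real (Suc k))}"
    have "closed {x. (x - p) \<bullet> n \<le> - (1 / real (Suc k))}"
      by (intro closed_Collect_le continuous_intros)
    then show "compact ?K" by (simp add: compact_Int_closed)
    show "{x. \<theta> k x * \<eta> x \<noteq> 0} \<subseteq> ?K"
    proof
      fix x assume "x \<in> {x. \<theta> k x * \<eta> x \<noteq> 0}"
      then have "\<theta> k x \<noteq> 0" "x \<in> cball p s" using supp by auto
      then have "- real (Suc k) * ((x - p) \<bullet> n) - 1 > 0"
        unfolding \<theta>_def exp_flat_def by (metis not_less)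
      then have "(x - p) \<bullet> n \<le> - (1 / real (Suc k))" by (simp add: field_simps)
      then show "x \<in> ?K" using \<open>x \<in> cball p s\<close> by simp
    qed
    have "- (1 / real (Suc k)) < 0" by simp
    then show "?K \<subseteq> ?P" using r(2) unfolding half_ball_def by (fastforce intro: order.strict_trans1)
  qed
  \<comment> \<open>Stated for a general field F because it is applied twice, to \<open>G\<close>
    and to the \<open>jacobian\<close>; by \<open>step\<close> the two sequences coincide.\<close>
  have lim: "(\<lambda>k. LINT x:?P|lebesgue. (\<theta> k x * \<eta> x) * F x $ i $ j) \<longlonglongrightarrow> (LINT x:?P|lebesgue. \<eta> x *\<^sub>R F x) $ i $ j"
    if F: "set_integrable lebesgue ?P (\<lambda>x. \<eta> x *\<^sub>R F x)" for F :: "real^3 \<Rightarrow> real^3^3" and i j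
  proof -
    let ?f = "\<lambda>x. (indicator ?P x *\<^sub>R (\<eta> x *\<^sub>R F x)) $ i $ j"
    have int: "integrable lebesgue ?f"
      using F unfolding set_integrable_def by (rule integrable_bounded_linear[OF comp])
    have "(\<lambda>k. \<integral>x. \<theta> k x * ?f x \<partial>lebesgue) \<longlonglongrightarrow> (\<integral>x. ?f x \<partial>lebesgue)"
    proof (rule integral_dominated_convergence)
      show "?f \<in> borel_measurable lebesgue" using int by (rule borel_measurable_integrable)
      moreover have "\<theta> k \<in> borel_measurable lebesgue" for k
        by (rule measurable_completion) (use \<eta>m[OF \<theta>] in simp)
      ultimately show "(\<lambda>x. \<theta> k x * ?f x) \<in> borel_measurable lebesgue" for k
        by (intro borel_measurable_times)
      show "integrable lebesgue (\<lambda>x. \<bar>?f x\<bar>)" using int by (rule integrable_abs)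
      show "AE x in lebesgue. (\<lambda>k. \<theta> k x * ?f x) \<longlonglongrightarrow> ?f x"
      proof (rule AE_I2)
        fix x show "(\<lambda>k. \<theta> k x * ?f x) \<longlonglongrightarrow> ?f x"
        proof (cases "x \<in> ?P")
          case True
          show ?thesis using tendsto_mult_right[OF \<theta>_lim[OF True], of "?f x"] by simp
        qed auto
      qed
      show "AE x in lebesgue. norm (\<theta> k x * ?f x) \<le> \<bar>?f x\<bar>" for k
        using \<theta>_bd[of k] by (intro AE_I2) (auto simp: abs_mult intro!: mult_left_le_one_le)
    qed
    moreover have "(\<integral>x. ?f x \<partial>lebesgue) = (LINT x:?P|lebesgue. \<eta> x *\<^sub>R F x) $ i $ j"
      using F integral_bounded_linear[OF comp] unfolding set_integrable_def set_lebesgue_integral_def by blast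
    moreover have "(\<integral>x. \<theta> k x * ?f x \<partial>lebesgue) = (LINT x:?P|lebesgue. (\<theta> k x * \<eta> x) * F x $ i $ j)" for k
      unfolding set_lebesgue_integral_def by (simp add: mult_ac)
    ultimately show ?thesis by simp
  qed
  have "set_integrable lebesgue ?P (\<lambda>x. \<eta> x *\<^sub>R jacobian u (at x))"
    unfolding set_integrable_def J_def[symmetric] by (rule Jint')
  from lim[OF this] lim[OF I1]
  have "(LINT x:?P|lebesgue. \<eta> x *\<^sub>R G x) = (LINT x:?P|lebesgue. \<eta> x *\<^sub>R jacobian u (at x))"
    unfolding step vec_eq_iff using LIMSEQ_unique by blast
  also have "\<dots> = (LINT x:?P|lborel. \<eta> x *\<^sub>R jacobian u (at x))"
    unfolding set_lebesgue_integral_def J_def[symmetric] using Jm by (intro integral_completion) simp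
  finally show ?thesis .
qed

section \<open>Blow-up at an interface point\<close>

lemma bounded_compact_support:
  fixes w :: "'a::euclidean_space \<Rightarrow> real"
  assumes "continuous_on UNIV w" "{x. w x \<noteq> 0} \<subseteq> cball 0 1"
  obtains B where "B \<ge> 0" "\<And>x. \<bar>w x\<bar> \<le> B * indicator (cball 0 1) x" "\<And>x. \<bar>w x\<bar> \<le> B"
proof -
  have "bounded (w ` cball 0 1)"
    by (intro compact_imp_bounded compact_continuous_image continuous_on_subset[OF assms(1)]) auto
  then obtain B where B: "\<And>x. x \<in> cball 0 1 \<Longrightarrow> norm (w x) \<le> B" unfolding bounded_iff by blast
  from this[of 0] have B0: "B \<ge> 0" using norm_ge_zero[of "w 0"] by (simp del: norm_ge_zero)
  have 1: "\<bar>w x\<bar> \<le> B * indicator (cball 0 1) x" for x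
    using B[of x] assms(2) by (auto simp: indicator_def)
  have "B * indicator (cball 0 1) x \<le> B" for x :: 'a
    using B0 by (auto simp: indicator_def)
  from that[OF B0 1 order_trans[OF 1 this]] show ?thesis .
qed

text \<open>Substituting x = p + \<epsilon> y produces the factor \<epsilon>^3, which the division
  cancels. On the unit ball, where \<open>w\<close> lives, the rescaled domain is the half space,
  and K(p + \<epsilon> y) tends to L there under the constant bound supplied by M.\<close>

lemma half_ball_blowup:
  fixes K :: "real^3 \<Rightarrow> 'b::euclidean_space"
  assumes cont: "continuous_on (half_ball p n r) K"
    and lim: "(K \<longlongrightarrow> L) (at p within half_ball p n r)"
    and bound: "\<And>x. x \<in> half_ball p n r \<inter> cball p s \<Longrightarrow> norm (K x) \<le> M"
    and s: "0 < s" "s < r"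
    and w: "continuous_on UNIV w" "{y. w y \<noteq> 0} \<subseteq> cball 0 1"
    and \<epsilon>_def: "\<And>m. \<epsilon> m = s / real (Suc m)"
  shows "(\<lambda>m. (LINT x:half_ball p n r|lborel. w ((1 / \<epsilon> m) *\<^sub>R (x - p)) *\<^sub>R K x) /\<^sub>R \<epsilon> m ^ 3)
    \<longlonglongrightarrow> (LINT y:{y. y \<bullet> n < 0}|lborel. w y) *\<^sub>R L"
proof -
  let ?P = "half_ball p n r" and ?H = "{y. y \<bullet> n < 0}"
  have \<epsilon>: "\<epsilon> m > 0" "\<epsilon> m \<le> s" for m
    using s by (auto simp: \<epsilon>_def field_simps)
  have \<epsilon>0: "\<epsilon> \<longlonglongrightarrow> 0"
  proof -
    have "(\<lambda>m. s * (1 / real (Suc m))) \<longlonglongrightarrow> s * 0"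
      by (intro tendsto_mult tendsto_const LIMSEQ_Suc[OF lim_1_over_n])
    then show ?thesis by (simp add: \<epsilon>_def[abs_def])
  qed
  have wm [measurable]: "w \<in> borel_measurable borel" by (rule borel_measurable_continuous_onI[OF w(1)])
  have Km [measurable]: "(\<lambda>x. indicator ?P x *\<^sub>R K x) \<in> borel_measurable borel"
    using borel_measurable_continuous_on_indicator[OF half_ball_borel cont] .
  obtain B where B: "B \<ge> 0" "\<And>x. \<bar>w x\<bar> \<le> B * indicator (cball 0 1) x" "\<And>x. \<bar>w x\<bar> \<le> B"
    using bounded_compact_support[OF w] by blast
  define h where "h m y = w y *\<^sub>R (indicator ?P (p + \<epsilon> m *\<^sub>R y) *\<^sub>R K (p + \<epsilon> m *\<^sub>R y))" for m y
  have hm: "h m \<in> borel_measurable lborel" for m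
  proof -
    have "(\<lambda>y. indicator ?P (p + \<epsilon> m *\<^sub>R y) *\<^sub>R K (p + \<epsilon> m *\<^sub>R y)) \<in> borel_measurable borel"
      by (rule measurable_compose[OF _ Km]) measurable
    then show ?thesis unfolding h_def by measurable
  qed
  have resc: "(LINT x:?P|lborel. w ((1 / \<epsilon> m) *\<^sub>R (x - p)) *\<^sub>R K x) /\<^sub>R \<epsilon> m ^ 3 = (\<integral>y. h m y \<partial>lborel)" for m
  proof -
    let ?f = "\<lambda>x. w ((1 / \<epsilon> m) *\<^sub>R (x - p)) *\<^sub>R (indicator ?P x *\<^sub>R K x)"
    have "?f \<in> borel_measurable borel" by measurable
    then have "(\<integral>x. ?f x \<partial>lborel) = \<bar>\<epsilon> m\<bar> ^ DIM(real^3) *\<^sub>R (\<integral>y. ?f (p + \<epsilon> m *\<^sub>R y) \<partial>lborel)"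
      using \<epsilon>[of m] by (intro integral_lborel_affine) auto
    moreover have "?f (p + \<epsilon> m *\<^sub>R y) = h m y" for y using \<epsilon>[of m] by (simp add: h_def)
    moreover have "(LINT x:?P|lborel. w ((1 / \<epsilon> m) *\<^sub>R (x - p)) *\<^sub>R K x) = (\<integral>x. ?f x \<partial>lborel)"
      unfolding set_lebesgue_integral_def by (intro Bochner_Integration.integral_cong) auto
    ultimately show ?thesis using \<epsilon>[of m] by simp
  qed
  \<comment> \<open>Because \<epsilon> |y| \<le> s < r, membership in the ball is automatic and only
    the sign of y . n matters, the same for every m.\<close>
  have inP: "p + \<epsilon> m *\<^sub>R y \<in> ?P \<longleftrightarrow> y \<in> ?H" if "norm y \<le> 1" for m y
  proof -
    have "\<epsilon> m * norm y \<le> s" using \<epsilon>[of m] that mult_mono[of "\<epsilon> m" s "norm y" 1] by simp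
    then have "p + \<epsilon> m *\<^sub>R y \<in> ball p r" using s \<epsilon>[of m] by (simp add: dist_norm)
    then show ?thesis using \<epsilon>[of m] by (simp add: half_ball_def mult_less_0_iff)
  qed
  have incb: "p + \<epsilon> m *\<^sub>R y \<in> cball p s" if "norm y \<le> 1" for m y
    using \<epsilon>[of m] that mult_mono[of "\<epsilon> m" s "norm y" 1] by (simp add: dist_norm)
  have w0: "w y = 0" if "\<not> norm y \<le> 1" for y using w(2) that by auto
  define g where "g y = (indicator ?H y * w y) *\<^sub>R L" for y
  have hlim: "(\<lambda>m. h m y) \<longlonglongrightarrow> g y" for y
  proof (cases "norm y \<le> 1 \<and> y \<in> ?H")
    case True
    have "filterlim (\<lambda>m. p + \<epsilon> m *\<^sub>R y) (at p within ?P) sequentially"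
      unfolding filterlim_at
    proof
      show "\<forall>\<^sub>F m in sequentially. p + \<epsilon> m *\<^sub>R y \<in> ?P \<and> p + \<epsilon> m *\<^sub>R y \<noteq> p"
        using True inP \<epsilon> by (intro always_eventually) (auto simp: less_le)
      have "(\<lambda>m. p + \<epsilon> m *\<^sub>R y) \<longlonglongrightarrow> p + 0 *\<^sub>R y" by (intro tendsto_intros \<epsilon>0)
      then show "(\<lambda>m. p + \<epsilon> m *\<^sub>R y) \<longlonglongrightarrow> p" by simp
    qed
    from filterlim_compose[OF lim this]
    have "(\<lambda>m. w y *\<^sub>R K (p + \<epsilon> m *\<^sub>R y)) \<longlonglongrightarrow> w y *\<^sub>R L" by (intro tendsto_intros)
    moreover have "h m y = w y *\<^sub>R K (p + \<epsilon> m *\<^sub>R y)" for m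
      using True inP[of y m] by (simp add: h_def)
    moreover have "g y = w y *\<^sub>R L" using True by (simp add: g_def)
    ultimately show ?thesis by (simp only:)
  next
    case False
    have "h m y = 0" for m
      using False inP[of y m] w0[of y] by (cases "norm y \<le> 1") (auto simp: h_def)
    moreover have "g y = 0" using False w0[of y] by (auto simp: g_def)
    ultimately show ?thesis by simp
  qed
  have H: "?H \<in> sets borel" by (intro borel_open open_Collect_less continuous_intros)
  have "(\<lambda>m. \<integral>y. h m y \<partial>lborel) \<longlonglongrightarrow> (\<integral>y. g y \<partial>lborel)"
  proof (rule integral_dominated_convergence)
    show "g \<in> borel_measurable lborel" by (rule borel_measurable_LIMSEQ_metric[OF hm hlim])
    show "integrable lborel (\<lambda>y. B * \<bar>M\<bar> * indicator (cball 0 1) (y::real^3))"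
      using emeasure_bounded_finite[of "cball 0 1 :: (real^3) set"]
      by (intro integrable_mult_right integrable_real_indicator) auto
    show "AE y in lborel. norm (h m y) \<le> B * \<bar>M\<bar> * indicator (cball 0 1) y" for m
    proof (rule AE_I2)
      fix y
      show "norm (h m y) \<le> B * \<bar>M\<bar> * indicator (cball 0 1) y"
      proof (cases "norm y \<le> 1 \<and> y \<in> ?H")
        case True
        then have "norm (K (p + \<epsilon> m *\<^sub>R y)) \<le> \<bar>M\<bar>"
          using bound[of "p + \<epsilon> m *\<^sub>R y"] inP[of y m] incb[of y m] by auto
        then have "\<bar>w y\<bar> * norm (K (p + \<epsilon> m *\<^sub>R y)) \<le> B * \<bar>M\<bar>"
          using B by (intro mult_mono) auto
        then show ?thesis using True inP[of y m] by (simp add: h_def)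
      next
        case False
        then have "h m y = 0"
          using inP[of y m] w0[of y] by (cases "norm y \<le> 1") (auto simp: h_def)
        then show ?thesis using B by simp
      qed
    qed
  qed (use hm hlim in auto)
  moreover have "(\<integral>y. g y \<partial>lborel) = (LINT y:?H|lborel. w y) *\<^sub>R L"
  proof -
    have "integrable lborel (\<lambda>y. indicator (cball 0 1) y *\<^sub>R w y)"
      by (rule borel_integrable_compact) (auto intro: continuous_on_subset[OF w(1)])
    then have "integrable lborel (\<lambda>y. indicator ?H y *\<^sub>R (indicator (cball 0 1) y *\<^sub>R w y))"
      by (rule integrable_mult_indicator[rotated]) (simp add: H)
    moreover have "indicator (cball 0 1) y *\<^sub>R w y = w y" for y
      using w0[of y] by (auto simp: indicator_def)
    ultimately have "integrable lborel (\<lambda>y. indicator ?H y * w y)" by (simp only: real_scaleR_def)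
    then show ?thesis unfolding g_def set_lebesgue_integral_def by simp
  qed
  ultimately show ?thesis unfolding resc by (simp only:)
qed

section \<open>A radial bump and the integrals of its derivatives over half spaces\<close>

definition bump :: "'a::euclidean_space \<Rightarrow> real" where
  "bump y = exp_flat 1 (1 - y \<bullet> y)"

text \<open>The direction is the first argument, so that \<open>bump_deriv v\<close> is itself a
  scalar function that can be tested with and differentiated again.\<close>

definition bump_deriv :: "'a::euclidean_space \<Rightarrow> 'a \<Rightarrow> real" where
  "bump_deriv v y = exp_flat (exp_flat_deriv 1) (1 - y \<bullet> y) * (- 2 * (y \<bullet> v))"

lemma exp_flat_bump_has_derivative:
  "((\<lambda>y. exp_flat P (1 - y \<bullet> y)) has_derivative
     (\<lambda>h. exp_flat (exp_flat_deriv P) (1 - y \<bullet> y) * (- 2 * (y \<bullet> h)))) (at y)"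
proof -
  have "((\<lambda>y. 1 - y \<bullet> y) has_derivative (\<lambda>h. - 2 * (y \<bullet> h))) (at y)"
    by (auto intro!: derivative_eq_intros simp: inner_commute)
  from has_derivative_compose[OF this exp_flat_has_field_derivative[unfolded has_field_derivative_def]]
  show ?thesis .
qed

lemma bump_has_derivative: "(bump has_derivative (\<lambda>v. bump_deriv v y)) (at y)"
  using exp_flat_bump_has_derivative[of 1 y] by (simp add: bump_def[abs_def] bump_deriv_def)

lemma bump_deriv_has_derivative:
  "(bump_deriv v has_derivative (\<lambda>h. exp_flat (exp_flat_deriv 1) (1 - y \<bullet> y) * (- 2 * (h \<bullet> v))
      + exp_flat (exp_flat_deriv (exp_flat_deriv 1)) (1 - y \<bullet> y) * (- 2 * (y \<bullet> h)) * (- 2 * (y \<bullet> v)))) (at y)"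
proof -
  have "((\<lambda>y. - 2 * (y \<bullet> v)) has_derivative (\<lambda>h. - 2 * (h \<bullet> v))) (at y)"
    by (auto intro!: derivative_eq_intros)
  from has_derivative_mult[OF exp_flat_bump_has_derivative[of "exp_flat_deriv 1"] this]
  show ?thesis by (simp add: bump_deriv_def[abs_def])
qed

lemma bump_deriv_symmetric:
  "frechet_derivative (bump_deriv v) (at y) w = frechet_derivative (bump_deriv w) (at y) v"
  unfolding frechet_derivative_at[OF bump_deriv_has_derivative, symmetric]
  by (simp add: inner_commute)

lemma elementary_smooth_exp_flat_bump: "elementary_smooth (\<lambda>y::'a::euclidean_space. exp_flat P (1 - y \<bullet> y))"
proof -
  \<comment> \<open>The generators of the class are linear functionals, so y . y is written as a sum
    of squared coordinates.\<close>
  have "elementary_smooth (\<lambda>y::'a. exp_flat P (1 + (- 1) * (\<Sum>b\<in>Basis. (y \<bullet> b) * (y \<bullet> b))))"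
    by (intro elementary_smooth.intros elementary_smooth_sum)
  then show ?thesis by (simp flip: euclidean_inner)
qed

lemma elementary_smooth_bump: "elementary_smooth bump"
  using elementary_smooth_exp_flat_bump[of 1] by (simp add: bump_def[abs_def])

lemma elementary_smooth_bump_deriv: "elementary_smooth (bump_deriv v)"
  unfolding bump_deriv_def[abs_def]
  by (intro elementary_smooth.intros elementary_smooth_exp_flat_bump)

lemma exp_flat_bump_support: "{y. exp_flat P (1 - y \<bullet> y) \<noteq> 0} \<subseteq> cball 0 1"
proof
  fix y :: 'a assume "y \<in> {y. exp_flat P (1 - y \<bullet> y) \<noteq> 0}"
  then have "(norm y)\<^sup>2 < 1\<^sup>2" by (auto simp: exp_flat_def power2_norm_eq_inner split: if_splits)
  then have "norm y < 1" by (rule power_less_imp_less_base) simp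
  then show "y \<in> cball 0 1" by simp
qed

lemma bump_support: "{y. bump y \<noteq> 0} \<subseteq> cball 0 1" "{y. bump_deriv v y \<noteq> 0} \<subseteq> cball 0 1"
  using exp_flat_bump_support by (auto simp: bump_def bump_deriv_def)

lemma bump_deriv_linear:
  "bump_deriv (v + w) y = bump_deriv v y + bump_deriv w y"
  "bump_deriv (c *\<^sub>R v) y = c * bump_deriv v y"
  by (simp_all add: bump_deriv_def inner_add_right algebra_simps)

lemma bump_deriv_set_integrable: "S \<in> sets borel \<Longrightarrow> set_integrable lborel S (bump_deriv v)"
proof -
  assume S: "S \<in> sets borel"
  have "integrable lborel (\<lambda>y. indicator (cball 0 1) y *\<^sub>R bump_deriv v y)"
    by (rule borel_integrable_compact) (auto intro: elementary_smooth_continuous elementary_smooth_bump_deriv)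
  then have "integrable lborel (\<lambda>y. indicator S y *\<^sub>R (indicator (cball 0 1) y *\<^sub>R bump_deriv v y))"
    by (rule integrable_mult_indicator[rotated]) (simp add: S)
  moreover have "indicator (cball 0 1) y *\<^sub>R bump_deriv v y = bump_deriv v y" for y
    using bump_support(2)[of v] by (auto simp: indicator_def)
  ultimately show ?thesis unfolding set_integrable_def by (simp only:)
qed

lemma half_space_borel: "{y::'a::euclidean_space. y \<bullet> n < 0} \<in> sets borel"
  by (intro borel_open open_Collect_less continuous_intros)

text \<open>The bump decreases radially, so moving along n increases it wherever y . n < 0 and |y| <
  1. The integrand is thus nonnegative, and a zero integral would make a nonempty open half ball
  negligible.\<close>

lemma half_space_integral_bump_deriv_pos:
  fixes n :: "'a::euclidean_space"
  assumes n: "norm n = 1"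
  shows "(LINT y:{y. y \<bullet> n < 0}|lborel. bump_deriv n y) > 0"
proof -
  let ?f = "\<lambda>y. indicator {y. y \<bullet> n < 0} y *\<^sub>R bump_deriv n y"
  have flat: "exp_flat (exp_flat_deriv 1) x = (if x > 0 then (1 / x)\<^sup>2 * exp (- (1 / x)) else 0)" for x
    by (simp add: exp_flat_def exp_flat_deriv_def power2_eq_square)
  have pos: "bump_deriv n y > 0" if "y \<in> half_ball 0 n 1" for y
  proof -
    have "norm y < 1" "y \<bullet> n < 0" using that by (auto simp: half_ball_def)
    then have "(norm y)\<^sup>2 < 1" by (simp add: power_less_one_iff abs_square_less_1)
    then have "1 - y \<bullet> y > 0" by (simp add: power2_norm_eq_inner)
    then show ?thesis using \<open>y \<bullet> n < 0\<close> by (simp add: bump_deriv_def flat mult_pos_neg)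
  qed
  have nonneg: "?f y \<ge> 0" for y
    by (auto simp: bump_deriv_def flat indicator_def intro!: mult_nonpos_nonneg)
  have int: "integrable lborel ?f"
    using bump_deriv_set_integrable[OF half_space_borel] by (simp add: set_integrable_def)
  have "(\<integral>y. ?f y \<partial>lborel) \<noteq> 0"
  proof
    assume "(\<integral>y. ?f y \<partial>lborel) = 0"
    then have "AE y in lborel. ?f y = 0"
      using integral_nonneg_eq_0_iff_AE[OF int] nonneg by simp
    then have "AE y in lborel. y \<notin> half_ball 0 n 1"
      by eventually_elim (use pos in \<open>force simp: half_ball_def\<close>)
    then have "half_ball 0 n 1 \<in> null_sets lborel"
      by (subst AE_iff_null_sets) auto
    then have "negligible (half_ball 0 n 1)"
      by (simp add: negligible_iff_null_sets null_sets_completionI)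
    then have "half_ball 0 n 1 = {}"
      using open_not_negligible[OF open_half_ball] by blast
    moreover have "- (1/2) *\<^sub>R n \<in> half_ball 0 n 1"
      using n by (simp add: half_ball_def dot_square_norm)
    ultimately show False by simp
  qed
  moreover have "(\<integral>y. ?f y \<partial>lborel) \<ge> 0" using nonneg by (simp add: integral_nonneg)
  ultimately show ?thesis by (simp add: set_lebesgue_integral_def)
qed

text \<open>The half space is invariant under translations orthogonal to n, so the tangential part
  of v contributes nothing. This plays the role of the divergence theorem on the half space, whose
  outer normal is n.\<close>

lemma half_space_integral_bump_deriv:
  fixes n :: "'a::euclidean_space"
  assumes n: "norm n = 1"
  shows "(LINT y:{y. y \<bullet> n < 0}|lborel. bump_deriv v y)
    = (v \<bullet> n) * (LINT y:{y. y \<bullet> n < 0}|lborel. bump_deriv n y)"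
proof -
  let ?H = "{y. y \<bullet> n < 0}"
  define \<tau> where "\<tau> = v - (v \<bullet> n) *\<^sub>R n"
  have \<tau>n: "\<tau> \<bullet> n = 0" using n by (simp add: \<tau>_def inner_diff_left norm_eq_1)
  have v: "v = (v \<bullet> n) *\<^sub>R n + \<tau>" by (simp add: \<tau>_def)
  obtain B where B: "\<And>x. \<bar>bump_deriv \<tau> x\<bar> \<le> B"
    using bounded_compact_support[OF elementary_smooth_continuous[OF elementary_smooth_bump_deriv] bump_support(2)]
    by metis
  have \<tau>0: "(LINT y:?H|lborel. bump_deriv \<tau> y) = 0"
    by (rule integral_directional_derivative_eq_0[OF bump_has_derivative B bump_support(1) half_space_borel])
      (simp add: inner_add_left \<tau>n)
  have "(LINT y:?H|lborel. bump_deriv v y) = (LINT y:?H|lborel. bump_deriv ((v \<bullet> n) *\<^sub>R n) y + bump_deriv \<tau> y)"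
    by (simp only: bump_deriv_linear(1)[symmetric] v[symmetric])
  also have "\<dots> = (LINT y:?H|lborel. bump_deriv ((v \<bullet> n) *\<^sub>R n) y) + (LINT y:?H|lborel. bump_deriv \<tau> y)"
    by (intro set_integral_add bump_deriv_set_integrable half_space_borel)
  finally show ?thesis by (simp add: \<tau>0 bump_deriv_linear)
qed

text \<open>\<open>bump_deriv v\<close> is odd, and the reflection y to -y exchanges the two half
  spaces.\<close>

lemma half_space_integral_bump_deriv_minus:
  fixes n :: "'a::euclidean_space"
  shows "(LINT y:{y. y \<bullet> (- n) < 0}|lborel. bump_deriv v y) = - (LINT y:{y. y \<bullet> n < 0}|lborel. bump_deriv v y)"
proof -
  let ?f = "\<lambda>y. indicator {y. y \<bullet> (- n) < 0} y *\<^sub>R bump_deriv v y"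
  have "integrable lborel ?f"
    using bump_deriv_set_integrable[OF half_space_borel[of "- n"]] by (simp only: set_integrable_def)
  then have "?f \<in> borel_measurable lborel" by (rule borel_measurable_integrable)
  then have "?f \<in> borel_measurable borel" by (simp only: measurable_lborel2)
  from integral_lborel_affine[OF this, of "-1" 0]
  have "(\<integral>y. ?f y \<partial>lborel) = (\<integral>y. ?f (- y) \<partial>lborel)" by simp
  moreover have "?f (- y) = - (indicator {y. y \<bullet> n < 0} y *\<^sub>R bump_deriv v y)" for y
    by (simp add: bump_deriv_def indicator_def)
  ultimately show ?thesis by (simp only: set_lebesgue_integral_def Bochner_Integration.integral_minus)
qed

lemma bounded_near_limit:
  fixes K :: "'a::metric_space \<Rightarrow> 'b::real_normed_vector"
  assumes "(K \<longlongrightarrow> L) (at p within P)" "p \<notin> P"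
  obtains d where "d > 0" "\<And>x. x \<in> P \<Longrightarrow> dist x p < d \<Longrightarrow> norm (K x) \<le> norm L + 1"
proof -
  have "\<forall>\<^sub>F x in at p within P. dist (K x) L < 1" using assms(1) by (rule tendstoD) simp
  then obtain d where d: "d > 0" "\<And>x. x \<in> P \<Longrightarrow> x \<noteq> p \<Longrightarrow> dist x p < d \<Longrightarrow> dist (K x) L < 1"
    unfolding eventually_at by blast
  have "norm (K x) \<le> norm L + 1" if "x \<in> P" "dist x p < d" for x
    using d(2)[OF that(1) _ that(2)] assms(2) that(1) norm_triangle_sub[of "K x" L]
    by (fastforce simp: dist_norm)
  with d(1) show ?thesis by (rule that)
qed

lemma linear_matrix_entry:
  assumes "linear T" shows "bounded_linear (\<lambda>A::real^3^3. (T A :: real^3^3) $ l $ j)"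
  by (rule bounded_linear_compose[OF bounded_linear_matrix_entry assms[unfolded linear_conv_bounded_linear]])

text \<open>One weakly differentiable function with classical one-sided gradients: \<open>Lm\<close>
  is the limit from the side that n points away from, \<open>Lp\<close> the limit from the side it
  points into. No equation is assumed, since the rank-one jump is a property of gradients alone; the
  elastic equation enters only in \<open>traction_continuous\<close>.\<close>

locale interface_gradient =
  fixes \<Omega> :: "(real^3) set" and p n :: "real^3" and r :: real
    and u :: "real^3 \<Rightarrow> real^3" and G :: "real^3 \<Rightarrow> real^3^3" and Lm Lp :: "real^3^3"
  assumes open_\<Omega>: "open \<Omega>" and r: "r > 0" "ball p r \<subseteq> \<Omega>" and n: "norm n = 1"
    and wg: "weak_gradient \<Omega> u G"
    and diff_m: "u differentiable_on half_ball p n r"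
    and diff_p: "u differentiable_on half_ball p (- n) r"
    and cont_m: "continuous_on (half_ball p n r) (\<lambda>x. jacobian u (at x))"
    and cont_p: "continuous_on (half_ball p (- n) r) (\<lambda>x. jacobian u (at x))"
    and lim_m: "((\<lambda>x. jacobian u (at x)) \<longlongrightarrow> Lm) (at p within half_ball p n r)"
    and lim_p: "((\<lambda>x. jacobian u (at x)) \<longlongrightarrow> Lp) (at p within half_ball p (- n) r)"
begin

definition flux :: real where "flux = (LINT y:{y. y \<bullet> n < 0}|lborel. bump_deriv n y)"

lemma flux_pos: "flux > 0"
  unfolding flux_def by (rule half_space_integral_bump_deriv_pos[OF n])

text \<open>A radius on which the gradient is bounded from both sides, as dominated convergence
  requires. Existence of the limits at \<open>p\<close> provides one.\<close>

definition admissible_radius :: "real \<Rightarrow> bool" where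
  "admissible_radius s \<longleftrightarrow> 0 < s \<and> s < r \<and>
     (\<exists>M. \<forall>x \<in> (half_ball p n r \<union> half_ball p (- n) r) \<inter> cball p s. norm (jacobian u (at x)) \<le> M)"

lemma admissible_radius_exists: "\<exists>s. admissible_radius s"
proof -
  have p: "p \<notin> half_ball p n r" "p \<notin> half_ball p (- n) r" by (simp_all add: half_ball_def)
  obtain d1 where d1: "d1 > 0" "\<And>x. x \<in> half_ball p n r \<Longrightarrow> dist x p < d1 \<Longrightarrow> norm (jacobian u (at x)) \<le> norm Lm + 1"
    using bounded_near_limit[OF lim_m p(1)] by blast
  obtain d2 where d2: "d2 > 0" "\<And>x. x \<in> half_ball p (- n) r \<Longrightarrow> dist x p < d2 \<Longrightarrow> norm (jacobian u (at x)) \<le> norm Lp + 1"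
    using bounded_near_limit[OF lim_p p(2)] by blast
  define s where "s = min r (min d1 d2) / 2"
  have s: "0 < s" "s < r" "s < d1" "s < d2" using r d1 d2 by (auto simp: s_def)
  have "norm (jacobian u (at x)) \<le> max (norm Lm + 1) (norm Lp + 1)"
    if x: "x \<in> (half_ball p n r \<union> half_ball p (- n) r) \<inter> cball p s" for x
  proof -
    have "dist x p < d1" "dist x p < d2" using x s by (auto simp: dist_commute)
    then show ?thesis using x d1(2)[of x] d2(2)[of x] by (auto simp: le_max_iff_disj)
  qed
  then show ?thesis using s unfolding admissible_radius_def by blast
qed

definition scale :: "real \<Rightarrow> nat \<Rightarrow> real" where "scale s m = s / real (Suc m)"

text \<open>This is the derivative of the bump evaluated at a rescaled point, not the derivative of
  the rescaled bump: the chain rule factor 1/\<open>scale s m\<close> is left out. It is common to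
  all terms of the identities below and drops out of them.\<close>

definition bump_at :: "real \<Rightarrow> nat \<Rightarrow> real^3 \<Rightarrow> real^3 \<Rightarrow> real" where
  "bump_at s m v x = bump_deriv v ((1 / scale s m) *\<^sub>R (x - p))"

lemma scale_bounds: "0 < s \<Longrightarrow> 0 < scale s m" "0 < s \<Longrightarrow> scale s m \<le> s"
  by (auto simp: scale_def field_simps)

lemma elementary_smooth_bump_at: "elementary_smooth (bump_at s m v)"
  unfolding bump_at_def[abs_def] by (intro elementary_smooth_affine elementary_smooth_bump_deriv)

lemma scaled_support:
  assumes "0 < s" "{y. w y \<noteq> 0} \<subseteq> cball 0 1"
  shows "{x. w ((1 / scale s m) *\<^sub>R (x - p)) \<noteq> 0} \<subseteq> cball p s"
proof
  fix x assume "x \<in> {x. w ((1 / scale s m) *\<^sub>R (x - p)) \<noteq> 0}"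
  then have "norm ((1 / scale s m) *\<^sub>R (x - p)) \<le> 1" using assms(2) by auto
  then have "norm (x - p) / scale s m \<le> 1"
    unfolding norm_scaleR using scale_bounds(1)[OF assms(1), of m] by simp
  then have "norm (x - p) \<le> scale s m"
    using scale_bounds(1)[OF assms(1), of m] by (simp add: pos_divide_le_eq)
  then show "x \<in> cball p s"
    using scale_bounds(2)[OF assms(1), of m] by (simp add: dist_norm norm_minus_commute)
qed

lemma bump_at_support: "0 < s \<Longrightarrow> {x. bump_at s m v x \<noteq> 0} \<subseteq> cball p s"
  unfolding bump_at_def by (rule scaled_support[OF _ bump_support(2)])

lemma cball_subset: "s < r \<Longrightarrow> cball p s \<subseteq> \<Omega>"
  using r(2) by (rule subset_trans[rotated]) auto

lemma bump_at_integrable: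
  assumes "0 < s" "s < r" "P \<in> sets lebesgue"
  shows "set_integrable lebesgue P (\<lambda>x. bump_at s m v x *\<^sub>R G x)"
  by (rule set_integrable_elementary_smooth_scaleR[OF elementary_smooth_bump_at bump_at_support compact_cball
      weak_gradient_integrable[OF wg compact_cball cball_subset]]) (use assms in auto)

definition mass :: "real \<Rightarrow> nat \<Rightarrow> real^3 \<Rightarrow> real^3 \<Rightarrow> real^3^3" where
  "mass s m \<nu> v = (LINT x:half_ball p \<nu> r|lebesgue. bump_at s m v x *\<^sub>R G x)"

text \<open>On each half ball \<open>G\<close> is first exchanged for the \<open>jacobian\<close>,
  then blown up. The sign in the second limit is that of the opposite half space.\<close>

lemma mass_limit:
  assumes s: "admissible_radius s"
  shows "(\<lambda>m. mass s m n v /\<^sub>R scale s m ^ 3) \<longlonglongrightarrow> (flux * (v \<bullet> n)) *\<^sub>R Lm"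
    and "(\<lambda>m. mass s m (- n) v /\<^sub>R scale s m ^ 3) \<longlonglongrightarrow> (- flux * (v \<bullet> n)) *\<^sub>R Lp"
proof -
  obtain M where M: "\<And>x. x \<in> (half_ball p n r \<union> half_ball p (- n) r) \<inter> cball p s \<Longrightarrow> norm (jacobian u (at x)) \<le> M"
    and s': "0 < s" "s < r" using s unfolding admissible_radius_def by blast
  have lim: "(\<lambda>m. mass s m \<nu> v /\<^sub>R scale s m ^ 3) \<longlonglongrightarrow> (LINT y:{y. y \<bullet> \<nu> < 0}|lborel. bump_deriv v y) *\<^sub>R L"
    if diff: "u differentiable_on half_ball p \<nu> r"
      and cont: "continuous_on (half_ball p \<nu> r) (\<lambda>x. jacobian u (at x))"
      and lim: "((\<lambda>x. jacobian u (at x)) \<longlongrightarrow> L) (at p within half_ball p \<nu> r)"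
      and bound: "\<And>x. x \<in> half_ball p \<nu> r \<inter> cball p s \<Longrightarrow> norm (jacobian u (at x)) \<le> M" for \<nu> L
  proof -
    have "mass s m \<nu> v = (LINT x:half_ball p \<nu> r|lborel. bump_at s m v x *\<^sub>R jacobian u (at x))" for m
      unfolding mass_def
      by (rule weak_gradient_eq_jacobian_half_ball[OF wg r(2) s'(2) diff cont _ elementary_smooth_bump_at
            bump_at_support[OF s'(1)]]) (rule bound)
    then show ?thesis unfolding bump_at_def
      using half_ball_blowup[OF cont lim bound s' elementary_smooth_continuous[OF elementary_smooth_bump_deriv[of v]]
          bump_support(2) scale_def[of s]]
      by (simp only:)
  qed
  show "(\<lambda>m. mass s m n v /\<^sub>R scale s m ^ 3) \<longlonglongrightarrow> (flux * (v \<bullet> n)) *\<^sub>R Lm"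
    using lim[OF diff_m cont_m lim_m M] unfolding half_space_integral_bump_deriv[OF n, of v] flux_def[symmetric]
    by (simp add: mult.commute)
  show "(\<lambda>m. mass s m (- n) v /\<^sub>R scale s m ^ 3) \<longlonglongrightarrow> (- flux * (v \<bullet> n)) *\<^sub>R Lp"
    using lim[OF diff_p cont_p lim_p M]
    unfolding half_space_integral_bump_deriv_minus half_space_integral_bump_deriv[OF n, of v] flux_def[symmetric]
    by (simp add: mult.commute)
qed

text \<open>The plane between the half balls is a null set, and f vanishes outside the ball, which
  lies in \<Omega>.\<close>

lemma integral_split:
  fixes f :: "real^3 \<Rightarrow> 'b::euclidean_space"
  assumes int: "\<And>P. P \<in> sets lebesgue \<Longrightarrow> set_integrable lebesgue P f"
    and supp: "\<And>x. x \<notin> ball p r \<Longrightarrow> f x = 0"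
  shows "(LINT x:\<Omega>|lebesgue. f x)
    = (LINT x:half_ball p n r|lebesgue. f x) + (LINT x:half_ball p (- n) r|lebesgue. f x)"
proof -
  let ?A = "half_ball p n r" and ?B = "half_ball p (- n) r"
  have sets: "?A \<in> sets lebesgue" "?B \<in> sets lebesgue" "\<Omega> \<in> sets lebesgue"
    using borel_open[OF open_\<Omega>] by auto
  have "(LINT x:?A|lebesgue. f x) + (LINT x:?B|lebesgue. f x) = (LINT x:?A \<union> ?B|lebesgue. f x)"
    by (rule set_integral_Un[symmetric]) (auto simp: int sets, auto simp: half_ball_def)
  also have "\<dots> = (LINT x:\<Omega>|lebesgue. f x)"
    unfolding set_lebesgue_integral_def
  proof (rule integral_cong_AE)
    show "(\<lambda>x. indicator (?A \<union> ?B) x *\<^sub>R f x) \<in> borel_measurable lebesgue"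
      "(\<lambda>x. indicator \<Omega> x *\<^sub>R f x) \<in> borel_measurable lebesgue"
      using int[of "?A \<union> ?B"] int[of \<Omega>] sets unfolding set_integrable_def by auto
    have "n \<noteq> 0" using n by auto
    then have "negligible {x. n \<bullet> x = n \<bullet> p}" by (intro negligible_hyperplane) auto
    then have "AE x in lebesgue. x \<notin> {x. n \<bullet> x = n \<bullet> p}"
      unfolding negligible_iff_null_sets by (rule AE_not_in)
    then show "AE x in lebesgue. indicator (?A \<union> ?B) x *\<^sub>R f x = indicator \<Omega> x *\<^sub>R f x"
    proof eventually_elim
      fix x assume "x \<notin> {x. n \<bullet> x = n \<bullet> p}"
      then have "(x - p) \<bullet> n \<noteq> 0" by (simp add: inner_diff_left inner_commute[of _ n] inner_diff_right)
      then have "x \<in> ?A \<union> ?B \<longleftrightarrow> x \<in> ball p r" by (auto simp: half_ball_def)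
      then show "indicator (?A \<union> ?B) x *\<^sub>R f x = indicator \<Omega> x *\<^sub>R f x"
        using r(2) supp[of x] by (auto simp: indicator_def)
    qed
  qed
  finally show ?thesis by simp
qed

text \<open>Testing the weak gradient with a first derivative of the bump function, and using the symmetry
  of its second derivatives, shows that the curl of \<open>G\<close> vanishes; blown up at \<open>p\<close> this says that
  the jump of the gradient is \<open>a \<otimes> n\<close>.\<close>

lemma mass_curl_free:
  assumes s: "0 < s" "s < r"
  shows "(mass s m n (axis k 1) + mass s m (- n) (axis k 1)) $ i $ j
       = (mass s m n (axis j 1) + mass s m (- n) (axis j 1)) $ i $ k"
proof -
  have sets: "\<Omega> \<in> sets lebesgue" using borel_open[OF open_\<Omega>] by auto
  have tot: "mass s m n v + mass s m (- n) v = (LINT x:\<Omega>|lebesgue. bump_at s m v x *\<^sub>R G x)" for v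
    unfolding mass_def
    by (rule integral_split[symmetric])
      (use bump_at_integrable[OF s] bump_at_support[OF s(1)] s in fastforce)+
  \<comment> \<open>With v = e_k the right side pairs u_i with the mixed second derivative of the
    bump along k and j. It is thus unchanged when j and k are exchanged.\<close>
  have entry: "(LINT x:\<Omega>|lebesgue. bump_at s m v x *\<^sub>R G x) $ i $ j
      = - (LINT x:\<Omega>|lebesgue. u x $ i * ((1 / scale s m) * frechet_derivative (bump_deriv v)
            (at ((1 / scale s m) *\<^sub>R (x - p))) (axis j 1)))" for v j
  proof -
    have "test_function \<Omega> (\<lambda>x. bump_at s m v x *\<^sub>R (1::real))"
      by (rule test_function_elementary_smooth[OF elementary_smooth_bump_at bump_at_support[OF s(1)]
            compact_cball cball_subset[OF s(2)]])
    then have tf: "test_function \<Omega> (bump_at s m v)" by simp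
    have der: "(bump_at s m v has_derivative (\<lambda>h. frechet_derivative (bump_deriv v)
            (at ((1 / scale s m) *\<^sub>R (x - p))) ((1 / scale s m) *\<^sub>R h))) (at x)" for x
      unfolding bump_at_def[abs_def]
      by (rule has_derivative_compose[OF _ elementary_smooth_frechet(1)[OF elementary_smooth_bump_deriv]])
        (auto intro!: derivative_eq_intros)
    have fr: "frechet_derivative (bump_at s m v) (at x) (axis j 1)
        = (1 / scale s m) * frechet_derivative (bump_deriv v) (at ((1 / scale s m) *\<^sub>R (x - p))) (axis j 1)" for x
      unfolding frechet_derivative_at[OF der, symmetric]
      by (subst linear_scale[OF has_derivative_linear[OF elementary_smooth_frechet(1)[OF elementary_smooth_bump_deriv]]]) simp
    have "(LINT x:\<Omega>|lebesgue. bump_at s m v x *\<^sub>R G x) $ i $ j = (LINT x:\<Omega>|lebesgue. (bump_at s m v x *\<^sub>R G x) $ i $ j)"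
      using integral_bounded_linear[OF bounded_linear_matrix_entry[of i j] bump_at_integrable[OF s sets, unfolded set_integrable_def]]
      by (simp add: set_lebesgue_integral_def mult.assoc)
    also have "\<dots> = (LINT x:\<Omega>|lebesgue. G x $ i $ j * bump_at s m v x)"
      by (simp add: mult.commute)
    also have "\<dots> = - (LINT x:\<Omega>|lebesgue. u x $ i * frechet_derivative (bump_at s m v) (at x) (axis j 1))"
      using wg tf unfolding weak_gradient_def by simp
    finally show ?thesis unfolding fr .
  qed
  show ?thesis unfolding tot entry by (simp only: bump_deriv_symmetric)
qed

lemma gradient_jump: "Lm = Lp + outer_prod ((Lm - Lp) *v n) n"
proof -
  obtain s where s: "admissible_radius s" using admissible_radius_exists by blast
  then have s': "0 < s" "s < r" by (auto simp: admissible_radius_def)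
  have lim: "(\<lambda>m. ((mass s m n v + mass s m (- n) v) /\<^sub>R scale s m ^ 3) $ i $ j) \<longlonglongrightarrow> flux * (v \<bullet> n) * (Lm - Lp) $ i $ j" for v i j
  proof -
    from tendsto_add[OF mass_limit[OF s, of v]]
    have "(\<lambda>m. (mass s m n v + mass s m (- n) v) /\<^sub>R scale s m ^ 3) \<longlonglongrightarrow> (flux * (v \<bullet> n)) *\<^sub>R (Lm - Lp)"
      by (simp add: scaleR_add_right algebra_simps)
    from tendsto_vec_nth[OF tendsto_vec_nth[OF this, of i], of j] show ?thesis by simp
  qed
  \<comment> \<open>By \<open>mass_curl_free\<close> both limits belong to the same sequence; the
    positive constant \<open>flux\<close> can then be cancelled. Every row of the jump is hence
    parallel to n.\<close>
  have eq: "(Lm - Lp) $ i $ j * n $ k = (Lm - Lp) $ i $ k * n $ j" for i j k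
  proof -
    have "flux * (axis k 1 \<bullet> n) * (Lm - Lp) $ i $ j = flux * (axis j 1 \<bullet> n) * (Lm - Lp) $ i $ k"
      using lim[of "axis k 1" i j] lim[of "axis j 1" i k]
      unfolding vector_scaleR_component mass_curl_free[OF s', of _ k i j] by (rule LIMSEQ_unique)
    then have "flux * (n $ k * (Lm - Lp) $ i $ j) = flux * (n $ j * (Lm - Lp) $ i $ k)"
      by (simp only: inner_axis' inner_real_def mult_1 mult.assoc)
    then have "n $ k * (Lm - Lp) $ i $ j = n $ j * (Lm - Lp) $ i $ k"
      using flux_pos unfolding mult_cancel_left by simp
    then show ?thesis by (simp only: mult.commute)
  qed
  have nn: "(\<Sum>k\<in>UNIV. n $ k * n $ k) = 1" using n by (simp add: norm_eq_1 inner_vec_def)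
  have "(Lm - Lp) $ i $ j = ((Lm - Lp) *v n) $ i * n $ j" for i j
  proof -
    \<comment> \<open>Inserting |n|^2 = 1 makes room for one exchange of j and k by
      \<open>eq\<close>, after which the sum over k is the product of the jump with n.\<close>
    have "(Lm - Lp) $ i $ j = (\<Sum>k\<in>UNIV. (Lm - Lp) $ i $ j * n $ k * n $ k)"
      using nn by (simp add: sum_distrib_left[symmetric] mult.assoc)
    also have "\<dots> = (\<Sum>k\<in>UNIV. (Lm - Lp) $ i $ k * n $ j * n $ k)" by (simp only: eq)
    also have "\<dots> = ((Lm - Lp) *v n) $ i * n $ j"
      by (simp add: matrix_vector_mult_def sum_distrib_left mult_ac)
    finally show ?thesis .
  qed
  then have "Lm - Lp = outer_prod ((Lm - Lp) *v n) n"
    unfolding vec_eq_iff outer_prod_def by simp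
  then show ?thesis by (simp add: algebra_simps)
qed

text \<open>The test field is the rescaled bump times e_l, so its gradient has only row l, filled
  with the functions \<open>bump_at\<close>. The equation becomes an exact relation between the
  masses of the two half balls, with \<open>Ci\<close> acting on one and \<open>Ce\<close> on the
  other, and its rescaled limit is \<open>flux\<close> times the l-th component of the traction
  jump.\<close>

lemma traction_continuous:
  assumes lin: "linear Ci" "linear Ce" and D: "D \<in> sets lebesgue"
    and inD: "half_ball p n r \<subseteq> D" and outD: "half_ball p (- n) r \<inter> D = {}"
    and weak: "\<And>\<psi> :: real^3 \<Rightarrow> real^3. test_function \<Omega> \<psi> \<Longrightarrow>
           (LINT x:\<Omega>|lebesgue. piecewise_tensor D Ci Ce x (G x) \<bullet> jacobian \<psi> (at x)) = 0"
  shows "Ci Lm *v n = Ce Lp *v n"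
proof -
  obtain s where s: "admissible_radius s" using admissible_radius_exists by blast
  then have s': "0 < s" "s < r" by (auto simp: admissible_radius_def)
  have comp: "(Ci Lm *v n) $ l = (Ce Lp *v n) $ l" for l
  proof -
    \<comment> \<open>Component l of the stress contracted with the gradient of the bump. The scalar
      factor sits inside T, so the integral passes through the linear functional and yields T of a
      \<open>mass\<close>.\<close>
    define F where "F T m x = (\<Sum>j\<in>UNIV. (T (bump_at s m (axis j 1) x *\<^sub>R G x) :: real^3^3) $ l $ j)" for T m x
    have F_int: "set_integrable lebesgue P (F T m)"
      and F_mass: "(LINT x:half_ball p \<nu> r|lebesgue. F T m x) = (\<Sum>j\<in>UNIV. T (mass s m \<nu> (axis j 1)) $ l $ j)"
      if T: "linear T" and P: "P \<in> sets lebesgue" for T m P \<nu>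
    proof -
      have scal: "T (a *\<^sub>R X) $ l $ j = a * T X $ l $ j" for a X j
        by (simp add: linear_scale[OF T])
      have int: "integrable lebesgue (\<lambda>x. indicator P x *\<^sub>R T (bump_at s m (axis j 1) x *\<^sub>R G x) $ l $ j)"
        if P: "P \<in> sets lebesgue" for j P
        using integrable_bounded_linear[OF linear_matrix_entry[OF T, of l j]
            bump_at_integrable[OF s' P, unfolded set_integrable_def, of m "axis j 1"]]
        by (simp only: scal real_scaleR_def)
      show "set_integrable lebesgue P (F T m)"
        unfolding set_integrable_def F_def scaleR_sum_right
        by (intro Bochner_Integration.integrable_sum int P)
      have H: "half_ball p \<nu> r \<in> sets lebesgue" by simp
      have "(LINT x:half_ball p \<nu> r|lebesgue. F T m x)
          = (\<Sum>j\<in>UNIV. \<integral>x. indicator (half_ball p \<nu> r) x *\<^sub>R T (bump_at s m (axis j 1) x *\<^sub>R G x) $ l $ j \<partial>lebesgue)"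
        unfolding set_lebesgue_integral_def F_def scaleR_sum_right
        by (intro Bochner_Integration.integral_sum int H)
      also have "\<dots> = (\<Sum>j\<in>UNIV. T (mass s m \<nu> (axis j 1)) $ l $ j)"
      proof (rule sum.cong[OF refl])
        fix j
        show "(\<integral>x. indicator (half_ball p \<nu> r) x *\<^sub>R T (bump_at s m (axis j 1) x *\<^sub>R G x) $ l $ j \<partial>lebesgue)
            = T (mass s m \<nu> (axis j 1)) $ l $ j"
          using integral_bounded_linear[OF linear_matrix_entry[OF T, of l j]
              bump_at_integrable[OF s' H, unfolded set_integrable_def, of m "axis j 1"]]
          unfolding mass_def set_lebesgue_integral_def by (simp only: scal real_scaleR_def)
      qed
      finally show "(LINT x:half_ball p \<nu> r|lebesgue. F T m x) = (\<Sum>j\<in>UNIV. T (mass s m \<nu> (axis j 1)) $ l $ j)" .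
    qed
    have zero: "(\<Sum>j\<in>UNIV. Ci (mass s m n (axis j 1)) $ l $ j) + (\<Sum>j\<in>UNIV. Ce (mass s m (- n) (axis j 1)) $ l $ j) = 0" for m
    proof -
      define \<psi> where "\<psi> x = bump ((1 / scale s m) *\<^sub>R (x - p)) *\<^sub>R (axis l 1 :: real^3)" for x
      have sc: "scale s m > 0" using scale_bounds(1)[OF s'(1)] .
      have tf: "test_function \<Omega> \<psi>"
        unfolding \<psi>_def[abs_def]
        by (rule test_function_elementary_smooth[OF elementary_smooth_affine[OF elementary_smooth_bump]
            scaled_support[OF s'(1) bump_support(1)] compact_cball cball_subset[OF s'(2)]])
      have der: "(\<psi> has_derivative (\<lambda>h. bump_deriv ((1 / scale s m) *\<^sub>R h) ((1 / scale s m) *\<^sub>R (x - p)) *\<^sub>R axis l 1)) (at x)" for x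
      proof -
        have "((\<lambda>x. bump ((1 / scale s m) *\<^sub>R (x - p))) has_derivative
           (\<lambda>h. bump_deriv ((1 / scale s m) *\<^sub>R h) ((1 / scale s m) *\<^sub>R (x - p)))) (at x)"
          by (rule has_derivative_compose[OF _ bump_has_derivative]) (auto intro!: derivative_eq_intros)
        then show ?thesis unfolding \<psi>_def[abs_def] by (rule has_derivative_scaleR_left)
      qed
      have jac: "jacobian \<psi> (at x) $ i $ j = (1 / scale s m) * bump_at s m (axis j 1) x * axis l 1 $ i" for x i j
        unfolding jacobian_entry frechet_derivative_at[OF der, symmetric]
        by (simp add: bump_deriv_linear bump_at_def)
      have F_eq: "X \<bullet> jacobian \<psi> (at x) = (1 / scale s m) * (\<Sum>j\<in>UNIV. bump_at s m (axis j 1) x * X $ l $ j)" for X x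
      proof -
        have "X \<bullet> jacobian \<psi> (at x) = (\<Sum>i\<in>UNIV. axis l 1 $ i * (\<Sum>j\<in>UNIV. (1 / scale s m) * (bump_at s m (axis j 1) x * X $ i $ j)))"
          by (simp add: inner_vec_def jac sum_distrib_left mult_ac)
        also have "\<dots> = (\<Sum>j\<in>UNIV. (1 / scale s m) * (bump_at s m (axis j 1) x * X $ l $ j))"
          by (simp add: axis_def if_distrib[of "\<lambda>c. c * _"] cong: if_cong)
        finally show ?thesis by (simp add: sum_distrib_left)
      qed
      define f where "f x = (if x \<in> D then F Ci m x else F Ce m x)" for x
      have "piecewise_tensor D Ci Ce x (G x) \<bullet> jacobian \<psi> (at x) = (1 / scale s m) * f x" for x
        unfolding F_eq f_def F_def piecewise_tensor_def
        by (simp add: linear_scale[OF lin(1)] linear_scale[OF lin(2)])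
      with weak[OF tf] have f0: "(LINT x:\<Omega>|lebesgue. f x) = 0"
        using sc by simp
      have f_int: "set_integrable lebesgue P f" if P: "P \<in> sets lebesgue" for P
      proof -
        have "integrable lebesgue (\<lambda>x. indicator (P \<inter> D) x *\<^sub>R F Ci m x + indicator (P - D) x *\<^sub>R F Ce m x)"
          using F_int[OF lin(1), of "P \<inter> D" m] F_int[OF lin(2), of "P - D" m] P D
          unfolding set_integrable_def by (intro Bochner_Integration.integrable_add) auto
        moreover have "indicator (P \<inter> D) x *\<^sub>R F Ci m x + indicator (P - D) x *\<^sub>R F Ce m x = indicator P x *\<^sub>R f x" for x
          by (auto simp: f_def indicator_def)
        ultimately show ?thesis unfolding set_integrable_def by (simp only:)
      qed
      have f_supp: "f x = 0" if "x \<notin> ball p r" for x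
      proof -
        have "bump_at s m v x = 0" for v using bump_at_support[OF s'(1), of m v] s' that by force
        then show ?thesis by (simp add: f_def F_def linear_0[OF lin(1)] linear_0[OF lin(2)])
      qed
      have "(LINT x:half_ball p n r|lebesgue. f x) = (LINT x:half_ball p n r|lebesgue. F Ci m x)"
        unfolding set_lebesgue_integral_def
        by (rule Bochner_Integration.integral_cong) (use inD in \<open>auto simp: f_def indicator_def\<close>)
      moreover have "(LINT x:half_ball p (- n) r|lebesgue. f x) = (LINT x:half_ball p (- n) r|lebesgue. F Ce m x)"
        unfolding set_lebesgue_integral_def
        by (rule Bochner_Integration.integral_cong) (use outD in \<open>auto simp: f_def indicator_def\<close>)
      ultimately show ?thesis
        using integral_split[OF f_int f_supp] f0 F_mass[OF lin(1), of "{}" n m] F_mass[OF lin(2), of "{}" "- n" m] by simp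
    qed
    have lim: "(\<lambda>m. (\<Sum>j\<in>UNIV. T (mass s m \<nu> (axis j 1)) $ l $ j) / scale s m ^ 3) \<longlonglongrightarrow> c * (T L *v n) $ l"
      if T: "linear T" and lm: "\<And>v. (\<lambda>m. mass s m \<nu> v /\<^sub>R scale s m ^ 3) \<longlonglongrightarrow> (c * (v \<bullet> n)) *\<^sub>R L" for T \<nu> c L
    proof -
      have "(\<lambda>m. \<Sum>j\<in>UNIV. T (mass s m \<nu> (axis j 1) /\<^sub>R scale s m ^ 3) $ l $ j) \<longlonglongrightarrow>
        (\<Sum>j\<in>UNIV. T ((c * (axis j 1 \<bullet> n)) *\<^sub>R L) $ l $ j)"
        by (intro tendsto_sum bounded_linear.tendsto[OF linear_matrix_entry[OF T]] lm)
      moreover have "(\<Sum>j\<in>UNIV. T ((c * (axis j 1 \<bullet> n)) *\<^sub>R L) $ l $ j) = c * (T L *v n) $ l"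
        by (simp add: linear_scale[OF T] inner_axis' matrix_vector_mult_def sum_distrib_left mult_ac)
      moreover have "(\<Sum>j\<in>UNIV. T (mass s m \<nu> (axis j 1) /\<^sub>R scale s m ^ 3) $ l $ j)
          = (\<Sum>j\<in>UNIV. T (mass s m \<nu> (axis j 1)) $ l $ j) / scale s m ^ 3" for m
        by (simp add: linear_scale[OF T] sum_distrib_left divide_inverse mult.commute)
      ultimately show ?thesis by (simp only:)
    qed
    have "(\<lambda>m. (\<Sum>j\<in>UNIV. Ci (mass s m n (axis j 1)) $ l $ j) / scale s m ^ 3
        + (\<Sum>j\<in>UNIV. Ce (mass s m (- n) (axis j 1)) $ l $ j) / scale s m ^ 3)
        \<longlonglongrightarrow> flux * (Ci Lm *v n) $ l + (- flux) * (Ce Lp *v n) $ l"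
      by (intro tendsto_add lim lin mass_limit[OF s])
    then have "(\<lambda>m. 0) \<longlonglongrightarrow> flux * (Ci Lm *v n) $ l + (- flux) * (Ce Lp *v n) $ l"
      by (simp only: add_divide_distrib[symmetric] zero) simp
    then have "flux * (Ci Lm *v n) $ l + (- flux) * (Ce Lp *v n) $ l = 0"
      by (simp add: LIMSEQ_const_iff)
    then show ?thesis using flux_pos by simp
  qed
  then show ?thesis by (simp add: vec_eq_iff)
qed

end

section \<open>Geometry of a polyhedron at a face\<close>

text \<open>Since p is not in A, it lies on or below the local graph. Moving down along e keeps the
  base point of the graph and lowers the height, so one lands strictly below the graph, which is an
  open condition that excludes A.\<close>

lemma lipschitz_boundary_no_thin_complement:
  fixes A :: "(real^3) set"
  assumes "lipschitz_boundary A" "p \<in> frontier A" "p \<notin> A" "r > 0"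
  shows "interior (ball p r - A) \<noteq> {}"
proof -
  from assms(1,2) obtain e \<psi> L s where e: "norm e = 1" "s > 0" "L-lipschitz_on UNIV (\<psi> :: real^3 \<Rightarrow> real)"
    and A: "A \<inter> ball p s = {x \<in> ball p s. \<psi> (x - (x \<bullet> e) *\<^sub>R e) < x \<bullet> e}"
    unfolding lipschitz_boundary_def by (elim ballE exE conjE) auto
  define B where "B = {x. \<psi> (x - (x \<bullet> e) *\<^sub>R e) > x \<bullet> e} \<inter> ball p s \<inter> ball p r"
  have cont: "continuous_on UNIV \<psi>" using e(3) lipschitz_on_continuous_on by blast
  have "open {x. \<psi> (x - (x \<bullet> e) *\<^sub>R e) > x \<bullet> e}"
    by (intro open_Collect_less continuous_intros continuous_on_compose2[OF cont]) auto
  then have "open B" unfolding B_def by (intro open_Int) auto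
  have "x \<notin> A" if "x \<in> B" for x
  proof
    assume "x \<in> A"
    with that have "x \<in> A \<inter> ball p s" by (simp add: B_def)
    then show False unfolding A using that by (simp add: B_def)
  qed
  then have sub: "B \<subseteq> ball p r - A" by (auto simp: B_def)
  define t where "t = min r s / 2"
  have t: "t > 0" "t < r" "t < s" using assms e by (auto simp: t_def)
  have "\<psi> (p - (p \<bullet> e) *\<^sub>R e) \<ge> p \<bullet> e"
  proof (rule ccontr)
    assume "\<not> ?thesis"
    then have "p \<in> A \<inter> ball p s" unfolding A using e(2) by simp
    then show False using assms(3) by simp
  qed
  moreover have ee: "e \<bullet> e = 1" using e by (simp add: norm_eq_1)
  define q where "q = p - t *\<^sub>R e"
  have qe: "q \<bullet> e = p \<bullet> e - t" by (simp add: q_def inner_diff_left ee)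
  have "q - (q \<bullet> e) *\<^sub>R e = p - (p \<bullet> e) *\<^sub>R e"
    unfolding qe by (simp add: q_def scaleR_left_diff_distrib)
  ultimately have "q \<bullet> e < \<psi> (q - (q \<bullet> e) *\<^sub>R e)" using t qe by simp
  moreover have "dist p q = t" using t e by (simp add: q_def dist_norm)
  ultimately have "q \<in> B" using t by (simp add: B_def)
  then show ?thesis using \<open>open B\<close> sub interior_maximal by blast
qed

text \<open>In a small ball the boundary of D is a flat disc through p. Each open half is connected
  and misses that boundary, so it lies in the interior of D or outside D. The definition of the
  outer normal fixes the half that n points into.\<close>

lemma face_half_balls:
  assumes poly: "closed_polyhedron D N V E \<F>" and adm: "admissible_inclusion r0 \<Omega> D"
    and "open \<Omega>"
    and p: "p \<in> frontier D - (\<Union>e\<in>E. edge_segment V e)"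
    and nrm: "outer_unit_normal D \<F> p n"
  obtains r where "r > 0" "ball p r \<subseteq> \<Omega>"
    "ball p r \<inter> interior D = ball p r \<inter> {x. (x - p) \<bullet> n < 0}"
    "ball p r - D = ball p r \<inter> {x. (x - p) \<bullet> n > 0}"
    "p \<in> (\<Union>F\<in>\<F>. rel_interior F)"
proof -
  have "compact D"
    using poly homeomorphic_compactness[of D "cball 0 1 :: (real^3) set"] by (simp add: closed_polyhedron_def)
  then have "closed D" by (rule compact_imp_closed)
  then have pD: "p \<in> D" using p frontier_subset_eq by blast
  obtain F where F: "F \<in> \<F>" "p \<in> F" "\<And>x. x \<in> F \<Longrightarrow> (x - p) \<bullet> n = 0"
    using nrm by (auto simp: outer_unit_normal_def)
  have n1: "norm n = 1" "n \<bullet> n = 1" "n \<noteq> 0" using nrm by (auto simp: outer_unit_normal_def norm_eq_1)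
  have ip: "(x - p) \<bullet> n = n \<bullet> x - n \<bullet> p" for x
    by (simp add: inner_diff_right inner_commute[of _ n])
  have pf: "polygonal_face V E F'" if "F' \<in> \<F>" for F'
    using poly that by (auto simp: closed_polyhedron_def)
  have notfr: "p \<notin> rel_frontier F'" if "F' \<in> \<F>" for F'
  proof -
    obtain E' where "E' \<subseteq> E" "rel_frontier F' = (\<Union>e\<in>E'. edge_segment V e)"
      using pf[OF \<open>F' \<in> \<F>\<close>] by (auto simp: polygonal_face_def)
    then show ?thesis using p by blast
  qed
  have pri: "p \<in> rel_interior F"
    using notfr[OF F(1)] F(2) closure_subset by (auto simp: rel_frontier_def)
  \<comment> \<open>Distinct faces meet only in their relative frontiers, and these are unions of
    edges, which p avoids.\<close>
  have other: "p \<notin> F'" if "F' \<in> \<F>" "F' \<noteq> F" for F'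
  proof
    assume "p \<in> F'"
    moreover have "F \<inter> F' \<subseteq> rel_frontier F \<inter> rel_frontier F'"
      using poly that F(1) unfolding closed_polyhedron_def by blast
    ultimately show False using notfr[OF F(1)] F(2) by blast
  qed
  have aff: "affine hull F = {x. n \<bullet> x = n \<bullet> p}"
  proof (rule affine_dim_equal)
    show "affine (affine hull F)" "affine {x. n \<bullet> x = n \<bullet> p}" 
      by (simp_all add: affine_hyperplane)
    show "affine hull F \<noteq> {}" using F by auto
    show "affine hull F \<subseteq> {x. n \<bullet> x = n \<bullet> p}"
      by (intro hull_minimal affine_hyperplane) (use F(3) in \<open>simp add: ip subset_iff\<close>)
    show "aff_dim (affine hull F) = aff_dim {x. n \<bullet> x = n \<bullet> p}"
      using pf[OF F(1)] n1 by (simp add: polygonal_face_def)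
  qed
  obtain e1 where e1: "e1 > 0" "ball p e1 \<inter> affine hull F \<subseteq> F"
    using pri unfolding rel_interior_ball by auto
  have "closed (\<Union>(\<F> - {F}))"
    using poly pf by (intro closed_Union) (auto simp: closed_polyhedron_def polygonal_face_def compact_imp_closed)
  moreover have "p \<notin> \<Union>(\<F> - {F})" using other by blast
  ultimately have "open (- \<Union>(\<F> - {F}))" "p \<in> - \<Union>(\<F> - {F})" by blast+
  then obtain e2 where "e2 > 0" "ball p e2 \<subseteq> - \<Union>(\<F> - {F})" by (rule openE)
  then have e2: "e2 > 0" "ball p e2 \<inter> \<Union>(\<F> - {F}) = {}" by blast+
  obtain e3 where e3: "e3 > 0" "ball p e3 \<subseteq> \<Omega>"
    using adm pD \<open>open \<Omega>\<close> openE[of \<Omega> p] unfolding admissible_inclusion_def by blast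
  define r where "r = min e1 (min e2 e3)"
  have r: "r > 0" "r \<le> e1" "r \<le> e2" "r \<le> e3" using e1 e2 e3 by (auto simp: r_def)
  have fr: "frontier D = \<Union>\<F>" using poly by (simp add: closed_polyhedron_def)
  have frB: "ball p r \<inter> frontier D = ball p r \<inter> {x. (x - p) \<bullet> n = 0}" (is "?l = ?r")
  proof
    show "?l \<subseteq> ?r"
    proof
      fix x assume x: "x \<in> ?l"
      then have "x \<in> ball p e2" using r by auto
      then have "x \<in> F" using x e2 fr by blast
      then show "x \<in> ?r" using F(3) x by auto
    qed
    show "?r \<subseteq> ?l"
    proof
      fix x assume x: "x \<in> ?r"
      then have "x \<in> ball p e1 \<inter> affine hull F" using r unfolding aff by (auto simp: ip)
      then have "x \<in> F" using e1 by blast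
      then show "x \<in> ?l" using x fr F(1) by auto
    qed
  qed
  define Hp Hm where "Hp = ball p r \<inter> {x. (x - p) \<bullet> n > 0}" and "Hm = ball p r \<inter> {x. (x - p) \<bullet> n < 0}"
  have conv: "convex Hp" "convex Hm"
    using convex_halfspace_gt[of "n \<bullet> p" n] convex_halfspace_lt[of n "n \<bullet> p"]
    by (auto simp: Hp_def Hm_def ip intro!: convex_Int)
  have split: "H \<subseteq> interior D \<or> H \<inter> D = {}" if "convex H" "H \<inter> frontier D = {}" for H
  proof (rule ccontr)
    assume "\<not> ?thesis"
    moreover have "D - frontier D = interior D"
      using \<open>closed D\<close> interior_subset[of D] by (auto simp: frontier_def)
    ultimately have "H \<inter> D \<noteq> {}" "H - D \<noteq> {}" using that(2) interior_subset[of D] by blast+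
    then show False using connected_Int_frontier[OF convex_connected[OF that(1)]] that(2) by blast
  qed
  have z: "(x - p) \<bullet> n = 0" if "x \<in> ball p r" "x \<in> frontier D" for x
    using frB that by blast
  have "Hp \<inter> frontier D = {}" "Hm \<inter> frontier D = {}"
    using z order_less_irrefl by (auto simp only: Hp_def Hm_def disjoint_iff Int_iff mem_Collect_eq)
  note sp = split[OF conv(1) this(1)] split[OF conv(2) this(2)]
  have "Hp \<inter> D = {}"
  proof -
    obtain \<epsilon> where \<epsilon>: "\<epsilon> > 0" "\<And>t. 0 < t \<Longrightarrow> t < \<epsilon> \<Longrightarrow> p + t *\<^sub>R n \<notin> D"
      using nrm by (auto simp: outer_unit_normal_def)
    define t where "t = min \<epsilon> r / 2"
    have t: "t > 0" "t < \<epsilon>" "t < r" using \<epsilon> r by (auto simp: t_def)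
    then have "p + t *\<^sub>R n \<in> Hp" using n1 by (simp add: Hp_def dist_norm)
    then show ?thesis using sp(1) \<epsilon>(2)[OF t(1,2)] interior_subset by blast
  qed
  \<comment> \<open>Otherwise D would occupy only a piece of a plane in the ball. Then the
    complement of \<Omega> - D would have empty interior near its boundary point p, which a
    Lipschitz boundary rules out.\<close>
  have "Hm \<subseteq> interior D"
  proof (rule ccontr)
    assume "\<not> Hm \<subseteq> interior D"
    then have "Hm \<inter> D = {}" using sp by blast
    then have sub: "ball p r - (\<Omega> - D) \<subseteq> {x. n \<bullet> x = n \<bullet> p}"
      using \<open>Hp \<inter> D = {}\<close> e3 r unfolding Hp_def Hm_def
      by (fastforce simp: ip)
    have "p \<in> frontier (\<Omega> - D)"
    proof -
      have "p \<notin> interior (\<Omega> - D)" using pD interior_subset by blast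
      moreover have "p \<in> closure (\<Omega> - D)"
        unfolding closure_approachable
      proof (intro allI impI)
        fix e :: real assume "e > 0"
        define t where "t = min e r / 2"
        have t: "t > 0" "t < e" "t < r" using \<open>e > 0\<close> r by (auto simp: t_def)
        then have "p + t *\<^sub>R n \<in> Hp" using n1 by (simp add: Hp_def dist_norm)
        then have "p + t *\<^sub>R n \<in> \<Omega> - D" using \<open>Hp \<inter> D = {}\<close> e3 r unfolding Hp_def by auto
        then show "\<exists>y\<in>\<Omega> - D. dist y p < e" using t n1
          by (intro bexI[of _ "p + t *\<^sub>R n"]) (auto simp: dist_norm)
      qed
      ultimately show ?thesis by (simp add: frontier_def)
    qed
    then have "interior (ball p r - (\<Omega> - D)) \<noteq> {}"
      using adm pD r by (intro lipschitz_boundary_no_thin_complement) (auto simp: admissible_inclusion_def)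
    then have "interior {x. n \<bullet> x = n \<bullet> p} \<noteq> {}" using interior_mono[OF sub] by blast
    then show False using n1 by simp
  qed
  show thesis
  proof (rule that[of r])
    have nofr: "x \<notin> interior D" if "x \<in> frontier D" for x using that by (simp add: frontier_def)
    have z': "x \<in> frontier D" if "x \<in> ball p r" "(x - p) \<bullet> n = 0" for x
      using frB that by blast
    have tri: "x \<in> Hp \<or> x \<in> Hm \<or> x \<in> frontier D" if "x \<in> ball p r" for x
      using that z' linorder_less_linear[of "(x - p) \<bullet> n" 0] unfolding Hp_def Hm_def by blast
    have "frontier D \<subseteq> D" using \<open>closed D\<close> frontier_subset_eq by blast
    have sub: "Hp \<subseteq> ball p r" "Hm \<subseteq> ball p r" "interior D \<subseteq> D"
      by (auto simp: Hp_def Hm_def interior_subset)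
    show "ball p r \<inter> interior D = ball p r \<inter> {x. (x - p) \<bullet> n < 0}"
      unfolding Hm_def[symmetric]
      using tri nofr \<open>Hm \<subseteq> interior D\<close> \<open>Hp \<inter> D = {}\<close> sub by blast
    show "ball p r - D = ball p r \<inter> {x. (x - p) \<bullet> n > 0}"
      unfolding Hp_def[symmetric]
      using tri nofr \<open>Hm \<subseteq> interior D\<close> \<open>Hp \<inter> D = {}\<close> sub \<open>frontier D \<subseteq> D\<close> by blast
    show "ball p r \<subseteq> \<Omega>" using e3 r by auto
  qed (use r pri F in auto)
qed

section \<open>The jump of the shape derivative field\<close>

text \<open>Smoothness up to T extends each directional derivative separately. The extensions along
  the three axes are assembled into a matrix, and its value at p is the one-sided limit.\<close>

lemma smooth_upto_jacobian:
  assumes smooth: "smooth_upto S T u" and "open S" "p \<in> T"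
  obtains J where "u differentiable_on S" "continuous_on S (\<lambda>x. jacobian u (at x))"
    "((\<lambda>x. jacobian u (at x)) \<longlongrightarrow> J) (at p within S)"
proof -
  have C1: "Ck_upto (Suc 0) S T u" using smooth by (simp only: smooth_upto_def)
  then have "\<forall>j. \<exists>g. continuous_on (S \<union> T) g \<and> (\<forall>x\<in>S. g x = frechet_derivative u (at x) (axis j 1))"
    by (simp add: extends_continuously_def)
  then obtain g where g: "\<And>j. continuous_on (S \<union> T) (g j)"
    "\<And>j x. x \<in> S \<Longrightarrow> g j x = frechet_derivative u (at x) (axis j 1)" by metis
  define J where "J x = (\<chi> i j. g j x $ i)" for x
  have J: "J x = jacobian u (at x)" if "x \<in> S" for x
    using g(2)[OF that] by (simp add: J_def vec_eq_iff jacobian_entry)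
  have cont: "continuous_on (S \<union> T) J"
    unfolding J_def by (intro continuous_on_vec_lambda continuous_on_component g(1))
  show thesis
  proof
    show "u differentiable_on S" using C1 by simp
    have "continuous_on S J" using cont by (rule continuous_on_subset) simp
    then show "continuous_on S (\<lambda>x. jacobian u (at x))"
      by (rule continuous_on_eq) (simp add: J)
    have "(J \<longlongrightarrow> J p) (at p within S \<union> T)"
      using cont \<open>p \<in> T\<close> by (simp add: continuous_on_def)
    then have "(J \<longlongrightarrow> J p) (at p within S)" by (rule tendsto_within_subset) simp
    then show "((\<lambda>x. jacobian u (at x)) \<longlongrightarrow> J p) (at p within S)"
      by (rule Lim_transform_eventually) (simp add: eventually_at_filter J)
  qed
qed

lemma tendsto_matrix_vector_mult:
  fixes A :: "'a \<Rightarrow> real^'n^'m"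
  assumes "(A \<longlongrightarrow> L) F" "(x \<longlongrightarrow> y) F"
  shows "((\<lambda>t. A t *v x t) \<longlongrightarrow> L *v y) F"
  unfolding matrix_vector_mult_def
  by (intro tendsto_vec_lambda tendsto_sum tendsto_mult tendsto_vec_nth assms)

lemma b_field_tendsto:
  assumes C: "\<And>x. x \<in> S \<Longrightarrow> C x = T" and T: "linear T"
    and u: "((\<lambda>x. jacobian u (at x)) \<longlongrightarrow> Gu) (at p within S)"
    and v: "((\<lambda>x. jacobian v (at x)) \<longlongrightarrow> Gv) (at p within S)"
    and U: "(U \<longlongrightarrow> w) (at p within S)"
  shows "(b_field C U u v \<longlongrightarrow> (T Gu \<bullet> Gv) *\<^sub>R w - T Gu *v (Gv *v w) - T Gv *v (Gu *v w)) (at p within S)"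
proof -
  have T': "((\<lambda>x. T (A x)) \<longlongrightarrow> T L) (at p within S)" if "(A \<longlongrightarrow> L) (at p within S)" for A L
    using bounded_linear.tendsto[OF T[unfolded linear_conv_bounded_linear] that] .
  have "((\<lambda>x. (T (jacobian u (at x)) \<bullet> jacobian v (at x)) *\<^sub>R U x
      - T (jacobian u (at x)) *v (jacobian v (at x) *v U x) - T (jacobian v (at x)) *v (jacobian u (at x) *v U x))
      \<longlongrightarrow> (T Gu \<bullet> Gv) *\<^sub>R w - T Gu *v (Gv *v w) - T Gv *v (Gu *v w)) (at p within S)"
    by (intro tendsto_diff tendsto_scaleR tendsto_inner tendsto_matrix_vector_mult T' u v U)
  then show ?thesis
    by (rule Lim_transform_eventually) (simp add: eventually_at_filter b_field_def C Let_def)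
qed

text \<open>\<open>Lim\<close> is determined by convergence only along a nontrivial filter; the
  points p - t n, with t small and positive, provide the accumulation at p.\<close>

lemma half_ball_islimpt:
  assumes "r > 0" "norm n = 1" "half_ball p n r \<subseteq> S"
  shows "at p within S \<noteq> bot"
proof -
  have "p islimpt S"
    unfolding islimpt_approachable
  proof (intro allI impI)
    fix e :: real assume "e > 0"
    define t where "t = min e r / 2"
    have t: "0 < t" "t < e" "t < r" using \<open>e > 0\<close> assms(1) by (auto simp: t_def)
    have "n \<bullet> n = 1" "n \<noteq> 0" using assms(2) by (auto simp: norm_eq_1)
    then have "p - t *\<^sub>R n \<in> half_ball p n r" using t assms(2) by (simp add: half_ball_def dist_norm)
    then show "\<exists>x\<in>S. x \<noteq> p \<and> dist x p < e"
      using assms t \<open>n \<noteq> 0\<close> by (intro bexI[of _ "p - t *\<^sub>R n"]) (auto simp: dist_norm)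
  qed
  then show ?thesis by (simp add: trivial_limit_within)
qed

lemma elastic_interface:
  assumes "open \<Omega>" "closed D" "r > 0" "ball p r \<subseteq> \<Omega>" "norm n = 1"
    and inD: "half_ball p n r \<subseteq> interior D" and outD: "half_ball p (- n) r \<inter> D = {}"
    and pT: "p \<in> (\<Union>F\<in>\<F>. rel_interior F)"
    and lin: "linear Ci" "linear Ce"
    and sol: "elastic_solution \<Omega> (piecewise_tensor D Ci Ce) f u"
    and smooth: "smooth_up_to_faces \<Omega> D \<F> u"
  obtains Gi Ge a where
    "((\<lambda>x. jacobian u (at x)) \<longlongrightarrow> Gi) (at p within interior D)"
    "((\<lambda>x. jacobian u (at x)) \<longlongrightarrow> Ge) (at p within \<Omega> - D)"
    "Gi = Ge + outer_prod a n" "Ci Gi *v n = Ce Ge *v n"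
proof -
  have sub: "half_ball p (- n) r \<subseteq> \<Omega> - D"
    using outD \<open>ball p r \<subseteq> \<Omega>\<close> by (auto simp: half_ball_def)
  have "open (\<Omega> - D)" using \<open>open \<Omega>\<close> \<open>closed D\<close> by (rule open_Diff)
  obtain Gi where i: "u differentiable_on interior D" "continuous_on (interior D) (\<lambda>x. jacobian u (at x))"
    "((\<lambda>x. jacobian u (at x)) \<longlongrightarrow> Gi) (at p within interior D)"
    using smooth_upto_jacobian[OF _ open_interior pT] smooth unfolding smooth_up_to_faces_def by metis
  obtain Ge where e: "u differentiable_on \<Omega> - D" "continuous_on (\<Omega> - D) (\<lambda>x. jacobian u (at x))"
    "((\<lambda>x. jacobian u (at x)) \<longlongrightarrow> Ge) (at p within \<Omega> - D)"
    using smooth_upto_jacobian[OF _ \<open>open (\<Omega> - D)\<close> pT] smooth unfolding smooth_up_to_faces_def by metis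
  obtain G where G: "weak_gradient \<Omega> u G"
    and weak: "\<And>\<psi> :: real^3 \<Rightarrow> real^3. test_function \<Omega> \<psi> \<Longrightarrow>
           (LINT x:\<Omega>|lebesgue. piecewise_tensor D Ci Ce x (G x) \<bullet> jacobian \<psi> (at x)) = 0"
    using sol by (auto simp: elastic_solution_def H1_with_gradient_def)
  interpret interface_gradient \<Omega> p n r u G Gi Ge
    by unfold_locales
      (fact assms G differentiable_on_subset[OF i(1) inD] differentiable_on_subset[OF e(1) sub]
        continuous_on_subset[OF i(2) inD] continuous_on_subset[OF e(2) sub]
        tendsto_within_subset[OF i(3) inD] tendsto_within_subset[OF e(3) sub])+
  have "Ci Gi *v n = Ce Ge *v n"
  proof (rule traction_continuous[OF lin _ _ outD weak])
    show "D \<in> sets lebesgue" using borel_closed[OF \<open>closed D\<close>] by simp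
    show "half_ball p n r \<subseteq> D" using inD interior_subset by (rule subset_trans)
  qed
  with i(3) e(3) gradient_jump show thesis by (rule that)
qed

theorem proposition6p16:
  fixes r0 :: real
    and \<Omega> S D0 D1 :: "(real^3) set"
    and N :: nat
    and V0 V1 :: "nat \<Rightarrow> real^3"
    and E0 E1 :: "(nat \<times> nat) set"
    and \<F>0 \<F>1 :: "(real^3) set set"
    and mui lami mue lame :: real
    and Ci Ce :: "real^3^3 \<Rightarrow> real^3^3"
    and C :: "real^3 \<Rightarrow> real^3^3 \<Rightarrow> real^3^3"
    and U Ut f g u0 v0 b :: "real^3 \<Rightarrow> real^3"
  assumes "r0 > 0"
    and "open \<Omega>" and "connected \<Omega>" and "bounded \<Omega>" and "lipschitz_boundary \<Omega>"
    and "openin (top_of_set (frontier \<Omega>)) S"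
    and "closed_polyhedron D0 N V0 E0 \<F>0" and "admissible_inclusion r0 \<Omega> D0"
    and "closed_polyhedron D1 N V1 E1 \<F>1" and "admissible_inclusion r0 \<Omega> D1"
    and "W1_infty U"
    and "\<And>i. i < N \<Longrightarrow> U (V0 i) = V1 i - V0 i"
    and "closure {x. U x \<noteq> 0} \<subseteq> {x. infdist x D0 \<le> r0 / 4}"
    and "\<exists>i<N. V1 i - V0 i \<noteq> 0"
    and Ut_def: "Ut = (\<lambda>x. U x /\<^sub>R displacement_norm N V0 V1)"
    and "admissible_lame mui lami" and "admissible_lame mue lame"
    and Ci_def: "Ci = isotropic_tensor mui lami"
    and Ce_def: "Ce = isotropic_tensor mue lame"
    and C_def: "C = piecewise_tensor D0 Ci Ce"
    and "H_half_co \<Omega> S f" and "H_half_co \<Omega> S g"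
    and "elastic_solution \<Omega> C f u0" and "elastic_solution \<Omega> C g v0"
    and "smooth_up_to_faces \<Omega> D0 \<F>0 u0" and "smooth_up_to_faces \<Omega> D0 \<F>0 v0"
    and b_def: "b = b_field C Ut u0 v0"
  shows "\<forall>p \<in> frontier D0 - (\<Union>e\<in>E0. edge_segment V0 e). \<forall>n. outer_unit_normal D0 \<F>0 p n \<longrightarrow>
      (Lim (at p within interior D0) b - Lim (at p within \<Omega> - D0) b) \<bullet> n
      = - (Ut p \<bullet> n) *
        (moment_tensor Ci Ce n (sym_part (Lim (at p within \<Omega> - D0) (\<lambda>x. jacobian u0 (at x))))
          \<bullet> sym_part (Lim (at p within \<Omega> - D0) (\<lambda>x. jacobian v0 (at x))))"
proof (intro ballI allI impI)
  fix p n
  assume p: "p \<in> frontier D0 - (\<Union>e\<in>E0. edge_segment V0 e)" and nrm: "outer_unit_normal D0 \<F>0 p n"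
  have n: "norm n = 1" using nrm by (simp add: outer_unit_normal_def)
  have "compact D0"
    using \<open>closed_polyhedron D0 N V0 E0 \<F>0\<close> homeomorphic_compactness[of D0 "cball 0 1 :: (real^3) set"]
    by (simp add: closed_polyhedron_def)
  then have "closed D0" by (rule compact_imp_closed)
  obtain r where r: "r > 0" "ball p r \<subseteq> \<Omega>"
    and inner: "ball p r \<inter> interior D0 = ball p r \<inter> {x. (x - p) \<bullet> n < 0}"
    and outer: "ball p r - D0 = ball p r \<inter> {x. (x - p) \<bullet> n > 0}"
    and face: "p \<in> (\<Union>F\<in>\<F>0. rel_interior F)"
    using face_half_balls[OF \<open>closed_polyhedron D0 N V0 E0 \<F>0\<close> \<open>admissible_inclusion r0 \<Omega> D0\<close> \<open>open \<Omega>\<close> p nrm] by blast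
  have "half_ball p n r = ball p r \<inter> interior D0" "half_ball p (- n) r = ball p r - D0"
    unfolding inner outer by (simp_all add: half_ball_def)
  then have inD: "half_ball p n r \<subseteq> interior D0" and outD: "half_ball p (- n) r \<inter> D0 = {}"
    and out: "half_ball p (- n) r \<subseteq> \<Omega> - D0" using r(2) by blast+
  have lin: "linear Ci" "linear Ce" by (simp_all add: Ci_def Ce_def linear_isotropic_tensor)
  note interface = elastic_interface[OF \<open>open \<Omega>\<close> \<open>closed D0\<close> r n inD outD face lin]
  obtain Gi Ge a where u: "((\<lambda>x. jacobian u0 (at x)) \<longlongrightarrow> Gi) (at p within interior D0)"
    "((\<lambda>x. jacobian u0 (at x)) \<longlongrightarrow> Ge) (at p within \<Omega> - D0)"
    and Gi: "Gi = Ge + outer_prod a n" "Ci Gi *v n = Ce Ge *v n"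
    using interface[OF \<open>elastic_solution \<Omega> C f u0\<close>[unfolded C_def] \<open>smooth_up_to_faces \<Omega> D0 \<F>0 u0\<close>] by blast
  obtain Hi He c where v: "((\<lambda>x. jacobian v0 (at x)) \<longlongrightarrow> Hi) (at p within interior D0)"
    "((\<lambda>x. jacobian v0 (at x)) \<longlongrightarrow> He) (at p within \<Omega> - D0)"
    and Hi: "Hi = He + outer_prod c n" "Ci Hi *v n = Ce He *v n"
    using interface[OF \<open>elastic_solution \<Omega> C g v0\<close>[unfolded C_def] \<open>smooth_up_to_faces \<Omega> D0 \<F>0 v0\<close>] by blast
  have "continuous_on UNIV U" using \<open>W1_infty U\<close> by (simp add: W1_infty_def)
  then have "continuous_on UNIV Ut" unfolding Ut_def by (intro continuous_intros)
  \<comment> \<open>The field is continuous across the face, so both one-sided limits of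
    \<open>b\<close> involve the same vector \<open>Ut p\<close>.\<close>
  then have Ut: "(Ut \<longlongrightarrow> Ut p) (at p within A)" for A
    by (metis UNIV_I continuous_on_def subset_UNIV tendsto_within_subset)
  have nontriv: "at p within interior D0 \<noteq> bot" "at p within \<Omega> - D0 \<noteq> bot"
    using half_ball_islimpt[OF r(1) n inD] half_ball_islimpt[OF r(1) _ out] n by simp_all
  have "(b \<longlongrightarrow> (Ci Gi \<bullet> Hi) *\<^sub>R Ut p - Ci Gi *v (Hi *v Ut p) - Ci Hi *v (Gi *v Ut p)) (at p within interior D0)"
    unfolding b_def using interior_subset[of D0]
    by (intro b_field_tendsto lin u v Ut) (auto simp: C_def piecewise_tensor_def)
  then have bi: "Lim (at p within interior D0) b = (Ci Gi \<bullet> Hi) *\<^sub>R Ut p - Ci Gi *v (Hi *v Ut p) - Ci Hi *v (Gi *v Ut p)"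
    by (rule tendsto_Lim[OF nontriv(1)])
  have "(b \<longlongrightarrow> (Ce Ge \<bullet> He) *\<^sub>R Ut p - Ce Ge *v (He *v Ut p) - Ce He *v (Ge *v Ut p)) (at p within \<Omega> - D0)"
    unfolding b_def
    by (intro b_field_tendsto lin u v Ut) (auto simp: C_def piecewise_tensor_def)
  then have be: "Lim (at p within \<Omega> - D0) b = (Ce Ge \<bullet> He) *\<^sub>R Ut p - Ce Ge *v (He *v Ut p) - Ce He *v (Ge *v Ut p)"
    by (rule tendsto_Lim[OF nontriv(2)])
  \<comment> \<open>The second sign follows from 3 (\<mu> + \<lambda>) = (2 \<mu> + 3 \<lambda>) +
    \<mu>; it is what the acoustic tensor needs.\<close>
  have mu: "mui > 0" "mui + lami > 0"
    using \<open>admissible_lame mui lami\<close> by (auto simp: admissible_lame_def)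
  show "(Lim (at p within interior D0) b - Lim (at p within \<Omega> - D0) b) \<bullet> n
      = - (Ut p \<bullet> n) *
        (moment_tensor Ci Ce n (sym_part (Lim (at p within \<Omega> - D0) (\<lambda>x. jacobian u0 (at x))))
          \<bullet> sym_part (Lim (at p within \<Omega> - D0) (\<lambda>x. jacobian v0 (at x))))"
    unfolding bi be tendsto_Lim[OF nontriv(2) u(2)] tendsto_Lim[OF nontriv(2) v(2)]
    by (rule jump_identity[OF mu n Ci_def Ce_def Gi(1) Hi(1) Gi(2) Hi(2)])
qed

end
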